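(* Let $H$ be a Hopf algebra with bicovariant calculus $\Omega^1(H)$, $\Omega_0=\ker\epsilon/Q_H$ finite-dimensional, framed by the Maurer–Cartan form $e:\Omega_0\to\Omega^1(H)$. Any nondegenerate $\mathrm{Ad}$-invariant $\eta=\eta^{(1)}\otimes\eta^{(2)}\in\Omega_0\otimes\Omega_0$ defines a coframing $e^*=e\circ\eta:\Omega_0^*\to\Omega^1(H)$. The corresponding metric $g=e(\eta^{(1)})\otimes_He(\eta^{(2)})$ is symmetric in the sense $\wedge(g)=0$ if and only if $\eta^{(1)}\otimes\eta^{(2)}=\eta^{(2)}\otimes S^2\eta^{(1)}$. For any gauge field $A:\Omega_0\to\Omega^1(H)$, the cotorsion is given in terms of $e$ by $$D_Ae(v)=\mathrm de(v)+e(\pi_{\Omega_0}\tilde v_{(2)})\wedge A\big(\tilde\pi_{\Omega_0}((S\tilde v_{(1)})\tilde v_{(3)})\big),$$ that is, $D_Ae^*=(D_Ae)\circ\eta$, where $\tilde v\in\ker\epsilon$ is any lift of $v\in\Omega_0$.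
   Context: Everything is over a field $k$; $H$ has invertible antipode $S$. A bicovariant calculus is given by a right ideal $Q_H\subset\ker\epsilon$ stable under $\mathrm{Ad}(h)=h_{(2)}\otimes(Sh_{(1)})h_{(3)}$; $\Omega^1(H)=\Omega^1H/N_H$, where $\Omega^1H=\ker(H\otimes H\to H)$ with $\mathrm dh=1\otimes h-h\otimes1$ and $N_H$ corresponds to $H\otimes Q_H$ under $h\otimes g\mapsto hg_{(1)}\otimes g_{(2)}$. $\Omega_0$ carries the projected right coaction $\mathrm{Ad}$, written $v\mapsto v_{[0]}\otimes v_{[1]}$, and the map induced by $S^2$. $\pi_{\Omega_0}:\ker\epsilon\to\Omega_0$ is the quotient; $\tilde\pi_{\Omega_0}(h)=\pi_{\Omega_0}(h-\epsilon(h)1)$. The Maurer–Cartan form $e(v)$ is the class of $S\tilde v_{(1)}\otimes\tilde v_{(2)}$ in $\Omega^1(H)$ (modulo universal terms, $e(v)=S\tilde v_{(1)}\mathrm d\tilde v_{(2)}$). $\Omega^2(H)=\Omega^1(H)\otimes_H\Omega^1(H)/\ker(\mathrm{id}-\Psi)$, where $\Psi$ is the bimodule map with $\Psi(e(v)\otimes_He(w))=e(\pi_{\Omega_0}\tilde w_{(2)})\otimes_He(v\cdot(S\tilde w_{(1)})\tilde w_{(3)})$; $\wedge$ is the quotient map. $\eta$ is $\mathrm{Ad}$-invariant if $\eta^{(1)}{}_{[0]}\otimes\eta^{(2)}{}_{[0]}\otimes\eta^{(1)}{}_{[1]}\eta^{(2)}{}_{[1]}=\eta\otimes1$, and nondegenerate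 if $\eta:\Omega_0^*\to\Omega_0$, $\eta(w)=\eta^{(1)}\langle w,\eta^{(2)}\rangle$, is invertible. A coframing ($\Omega_0$-cobein) is a linear map $e^*:\Omega_0^*\to\Omega^1(H)$ such that $\Omega_0^*\otimes H\to\Omega^1(H)$, $w\otimes h\mapsto e^*(w)h$, is an isomorphism; its metric is $g=\sum_ae^*(f^a)\otimes_He(e_a)$ for dual bases $\{e_a\},\{f^a\}$ of $\Omega_0,\Omega_0^*$. $\Omega_0^*$ has right coaction defined by $\langle v,w_{[0]}\rangle w_{[1]}=\langle v_{[0]},w\rangle S^{-1}v_{[1]}$. The cotorsion of $A$ is the element $\sum_a D_Ae^*(f^a)\otimes_He(e_a)\in\Omega^2(H)\otimes_H\Omega^1(H)$, where $D_Ae^*(w)=\mathrm de^*(w)+e^*(w_{[0]})\wedge A(\tilde\pi_{\Omega_0}w_{[1]})$. *)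

theory Defs
  imports Complex_Main "HOL-Library.Multiset" "HOL-Library.Function_Algebras"
begin

section \<open>Tensor products\<close>

text \<open>
  An element of a tensor product is written as a formal sum of pure tensors, i.e. as a finite
  multiset of tuples: the multiset with members \<open>(m\<^sub>i, n\<^sub>i)\<close> stands for the sum of all
  \<open>m\<^sub>i \<otimes> n\<^sub>i\<close>.  Two formal sums are the same tensor iff they are related by \<open>tensor_eq\<close>
  (\<open>tensor3_eq\<close> for triple tensor products), so the tensor product is the quotient by this
  relation.  A map into a tensor product is given by a function choosing a representing formal sum,
  and all equations between tensors are stated with these relations.  The Sweedler
  expression \<open>F h\<^sub>1 h\<^sub>2\<close> is then the finite sum of \<open>F a b\<close> over the members \<open>(a, b)\<close> of
  the coproduct of \<open>h\<close>.
\<close>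

inductive additive_congruence ::
  "('p multiset \<Rightarrow> 'p multiset \<Rightarrow> bool) \<Rightarrow> 'p multiset \<Rightarrow> 'p multiset \<Rightarrow> bool"
  for R where
  base: "R t u \<Longrightarrow> additive_congruence R t u"
| refl: "additive_congruence R t t"
| sym: "additive_congruence R t u \<Longrightarrow> additive_congruence R u t"
| trans: "additive_congruence R t u \<Longrightarrow> additive_congruence R u v \<Longrightarrow> additive_congruence R t v"
| add: "additive_congruence R t u \<Longrightarrow> additive_congruence R (t + v) (u + v)"

text \<open>
  Defining relations of \<open>M \<otimes>\<^sub>R N\<close>, for a right action on \<open>M\<close> and a left action on \<open>N\<close>.
  Since \<open>m \<otimes> n + (-m) \<otimes> n = 0 \<otimes> n\<close> is identified with the empty sum, the quotient is a group,
  and it is the usual quotient of the free abelian group.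
\<close>

inductive tensor_relation ::
  "'m set \<Rightarrow> 'n set \<Rightarrow> ('m \<Rightarrow> 'r \<Rightarrow> 'm) \<Rightarrow> ('r \<Rightarrow> 'n \<Rightarrow> 'n)
    \<Rightarrow> ('m::ab_group_add \<times> 'n::ab_group_add) multiset \<Rightarrow> ('m \<times> 'n) multiset \<Rightarrow> bool"
  for M N ract lact where
  add_left: "m \<in> M \<Longrightarrow> m' \<in> M \<Longrightarrow> n \<in> N \<Longrightarrow>
    tensor_relation M N ract lact {#(m + m', n)#} {#(m, n), (m', n)#}"
| add_right: "m \<in> M \<Longrightarrow> n \<in> N \<Longrightarrow> n' \<in> N \<Longrightarrow>
    tensor_relation M N ract lact {#(m, n + n')#} {#(m, n), (m, n')#}"
| zero: "n \<in> N \<Longrightarrow> tensor_relation M N ract lact {#(0, n)#} {#}"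
| balanced: "m \<in> M \<Longrightarrow> n \<in> N \<Longrightarrow>
    tensor_relation M N ract lact {#(ract m r, n)#} {#(m, lact r n)#}"

abbreviation tensor_eq_on where
  "tensor_eq_on M N ract lact \<equiv> additive_congruence (tensor_relation M N ract lact)"

abbreviation tensor_eq where
  "tensor_eq \<equiv> tensor_eq_on UNIV UNIV"

abbreviation (input) ktensor_eq ::
  "('k \<Rightarrow> 'a \<Rightarrow> 'a) \<Rightarrow> ('k \<Rightarrow> 'b \<Rightarrow> 'b)
    \<Rightarrow> ('a::ab_group_add \<times> 'b::ab_group_add) multiset \<Rightarrow> ('a \<times> 'b) multiset \<Rightarrow> bool" where
  "ktensor_eq sA sB \<equiv> tensor_eq (\<lambda>a c. sA c a) sB"

inductive tensor3_relation ::
  "('k \<Rightarrow> 'a \<Rightarrow> 'a) \<Rightarrow> ('k \<Rightarrow> 'b \<Rightarrow> 'b) \<Rightarrow> ('k \<Rightarrow> 'c \<Rightarrow> 'c)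
    \<Rightarrow> ('a::ab_group_add \<times> 'b::ab_group_add \<times> 'c::ab_group_add) multiset
    \<Rightarrow> ('a \<times> 'b \<times> 'c) multiset \<Rightarrow> bool"
  for sA sB sC where
  add1: "tensor3_relation sA sB sC {#(a + a', b, c)#} {#(a, b, c), (a', b, c)#}"
| add2: "tensor3_relation sA sB sC {#(a, b + b', c)#} {#(a, b, c), (a, b', c)#}"
| add3: "tensor3_relation sA sB sC {#(a, b, c + c')#} {#(a, b, c), (a, b, c')#}"
| zero: "tensor3_relation sA sB sC {#(0, b, c)#} {#}"
| scale12: "tensor3_relation sA sB sC {#(sA r a, b, c)#} {#(a, sB r b, c)#}"
| scale23: "tensor3_relation sA sB sC {#(a, sB r b, c)#} {#(a, b, sC r c)#}"

abbreviation (input) tensor3_eq where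
  "tensor3_eq sA sB sC \<equiv> additive_congruence (tensor3_relation sA sB sC)"


section \<open>Hopf algebras\<close>

record ('k, 'h) hopf =
  hscale :: "'k \<Rightarrow> 'h \<Rightarrow> 'h"
  comult :: "'h \<Rightarrow> ('h \<times> 'h) multiset"
  counit :: "'h \<Rightarrow> 'k"
  antipode :: "'h \<Rightarrow> 'h"

abbreviation (input) HH_eq where
  "HH_eq C \<equiv> ktensor_eq (hscale C) (hscale C)"

definition comult2 :: "('k, 'h, 'z) hopf_scheme \<Rightarrow> 'h \<Rightarrow> ('h \<times> 'h \<times> 'h) multiset" where
  "comult2 C h = (\<Sum>(a, b)\<in>#comult C h. image_mset (\<lambda>(b1, b2). (a, b1, b2)) (comult C b))"

definition hopf_algebra :: "('k::field, 'h::ring_1, 'z) hopf_scheme \<Rightarrow> bool" where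
  "hopf_algebra C \<longleftrightarrow>
    vector_space (hscale C) \<and>
    (\<forall>c x y. hscale C c (x * y) = hscale C c x * y \<and> hscale C c (x * y) = x * hscale C c y) \<and>
    (\<forall>x y. HH_eq C (comult C (x + y)) (comult C x + comult C y)) \<and>
    (\<forall>c x. HH_eq C (comult C (hscale C c x))
      (image_mset (\<lambda>(a, b). (hscale C c a, b)) (comult C x))) \<and>
    (\<forall>x. tensor3_eq (hscale C) (hscale C) (hscale C)
      (\<Sum>(a, b)\<in>#comult C x. image_mset (\<lambda>(a1, a2). (a1, a2, b)) (comult C a))
      (comult2 C x)) \<and>
    Vector_Spaces.linear (hscale C) (*) (counit C) \<and>
    (\<forall>x. (\<Sum>(a, b)\<in>#comult C x. hscale C (counit C a) b) = x) \<and>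
    (\<forall>x. (\<Sum>(a, b)\<in>#comult C x. hscale C (counit C b) a) = x) \<and>
    (\<forall>x y. HH_eq C (comult C (x * y))
      (\<Sum>(a, b)\<in>#comult C x. image_mset (\<lambda>(a', b'). (a * a', b * b')) (comult C y))) \<and>
    HH_eq C (comult C 1) {#(1, 1)#} \<and>
    (\<forall>x y. counit C (x * y) = counit C x * counit C y) \<and>
    counit C 1 = 1 \<and>
    Vector_Spaces.linear (hscale C) (hscale C) (antipode C) \<and>
    (\<forall>x. (\<Sum>(a, b)\<in>#comult C x. antipode C a * b) = hscale C (counit C x) 1) \<and>
    (\<forall>x. (\<Sum>(a, b)\<in>#comult C x. a * antipode C b) = hscale C (counit C x) 1)"

definition Ad :: "('k, 'h::ring_1, 'z) hopf_scheme \<Rightarrow> 'h \<Rightarrow> ('h \<times> 'h) multiset" where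
  "Ad C h = image_mset (\<lambda>(a, b, c). (b, antipode C a * c)) (comult2 C h)"


section \<open>First order bicovariant calculi\<close>

text \<open>
  Quotient spaces are represented by a type together with a surjection from the space being
  divided whose kernel is the given subspace.
  \<^item> \<open>'v\<close> is \<open>\<Omega>\<^sub>0\<close>, with projection \<open>proj0\<close>, which is relevant on \<open>ker \<epsilon>\<close> only;
  \<^item> \<open>'w\<close> is \<open>\<Omega>\<^sup>1(H)\<close>, with projection \<open>proj1\<close>, which is relevant on \<open>\<Omega>\<^sup>1H\<close>, the kernel of
    the product of \<open>H \<otimes> H\<close>, only;
  \<^item> \<open>'x\<close> is \<open>\<Omega>\<^sup>2(H)\<close>; its projection is induced by \<open>wedge\<close> on pure tensors;
  \<^item> \<open>Psi\<close> represents \<open>\<Psi>\<close> on formal sums, and \<open>extd\<close> is the exterior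
    derivative from \<open>\<Omega>\<^sup>1(H)\<close> to \<open>\<Omega>\<^sup>2(H)\<close>.
\<close>

record ('k, 'h, 'v, 'w, 'x) calculus = "('k, 'h) hopf" +
  QH :: "'h set"
  vscale :: "'k \<Rightarrow> 'v \<Rightarrow> 'v"
  proj0 :: "'h \<Rightarrow> 'v"
  lact1 :: "'h \<Rightarrow> 'w \<Rightarrow> 'w"
  ract1 :: "'w \<Rightarrow> 'h \<Rightarrow> 'w"
  proj1 :: "('h \<times> 'h) multiset \<Rightarrow> 'w"
  lact2 :: "'h \<Rightarrow> 'x \<Rightarrow> 'x"
  ract2 :: "'x \<Rightarrow> 'h \<Rightarrow> 'x"
  Psi :: "('w \<times> 'w) multiset \<Rightarrow> ('w \<times> 'w) multiset"
  wedge :: "'w \<Rightarrow> 'w \<Rightarrow> 'x"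
  extd :: "'w \<Rightarrow> 'x"

definition bimodule ::
  "('k \<Rightarrow> 'h \<Rightarrow> 'h) \<Rightarrow> ('h::ring_1 \<Rightarrow> 'm::ab_group_add \<Rightarrow> 'm) \<Rightarrow> ('m \<Rightarrow> 'h \<Rightarrow> 'm) \<Rightarrow> bool" where
  "bimodule s la ra \<longleftrightarrow>
    (\<forall>a m n. la a (m + n) = la a m + la a n) \<and>
    (\<forall>a b m. la (a + b) m = la a m + la b m) \<and>
    (\<forall>a b m. la (a * b) m = la a (la b m)) \<and>
    (\<forall>m. la 1 m = m) \<and>
    (\<forall>a m n. ra (m + n) a = ra m a + ra n a) \<and>
    (\<forall>a b m. ra m (a + b) = ra m a + ra m b) \<and>
    (\<forall>a b m. ra m (a * b) = ra (ra m a) b) \<and>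
    (\<forall>m. ra m 1 = m) \<and>
    (\<forall>a b m. ra (la a m) b = la a (ra m b)) \<and>
    (\<forall>c m. la (s c 1) m = ra m (s c 1))"

definition ker_counit :: "('k::zero, 'h, 'z) hopf_scheme \<Rightarrow> 'h set" where
  "ker_counit C = {h. counit C h = 0}"

definition OmegaU1 :: "('h::ring_1 \<times> 'h) multiset set" where
  "OmegaU1 = {t. (\<Sum>(a, b)\<in>#t. a * b) = 0}"

text \<open>
  The sub-bimodule \<open>N\<^sub>H\<close>: the elements of \<open>\<Omega>\<^sup>1H\<close> that the isomorphism
  \<open>h \<otimes> g \<mapsto> h g\<^sub>1 \<otimes> g\<^sub>2\<close> from \<open>\<Omega>\<^sup>1H\<close> to \<open>H \<otimes> ker \<epsilon>\<close> sends into \<open>H \<otimes> Q\<^sub>H\<close>.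
\<close>

definition NH :: "('k, 'h::ring_1, 'v, 'w, 'x, 'z) calculus_scheme \<Rightarrow> ('h \<times> 'h) multiset set" where
  "NH C = {t \<in> OmegaU1. \<exists>z. set_mset z \<subseteq> UNIV \<times> QH C \<and>
    HH_eq C (\<Sum>(h, g)\<in>#t. image_mset (\<lambda>(g1, g2). (h * g1, g2)) (comult C g)) z}"

definition bicovariant_calculus ::
  "('k::field, 'h::ring_1, 'v::ab_group_add, 'w::ab_group_add, 'x, 'z) calculus_scheme \<Rightarrow> bool" where
  "bicovariant_calculus C \<longleftrightarrow>
    \<comment> \<open>right ideal in the augmentation ideal, stable under \<open>Ad\<close>\<close>
    QH C \<subseteq> ker_counit C \<and> 0 \<in> QH C \<and>
    (\<forall>x\<in>QH C. \<forall>y\<in>QH C. x + y \<in> QH C) \<and>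
    (\<forall>x\<in>QH C. \<forall>h. x * h \<in> QH C) \<and>
    (\<forall>x\<in>QH C. \<exists>z. set_mset z \<subseteq> QH C \<times> UNIV \<and> HH_eq C (Ad C x) z) \<and>
    \<comment> \<open>\<open>\<Omega>\<^sub>0 = ker \<epsilon> / Q\<^sub>H\<close>\<close>
    vector_space (vscale C) \<and>
    (\<forall>x\<in>ker_counit C. \<forall>y\<in>ker_counit C. proj0 C (x + y) = proj0 C x + proj0 C y) \<and>
    (\<forall>c. \<forall>x\<in>ker_counit C. proj0 C (hscale C c x) = vscale C c (proj0 C x)) \<and>
    proj0 C ` ker_counit C = UNIV \<and>
    (\<forall>x\<in>ker_counit C. proj0 C x = 0 \<longleftrightarrow> x \<in> QH C) \<and>
    \<comment> \<open>\<open>\<Omega>\<^sup>1(H) = \<Omega>\<^sup>1H / N\<^sub>H\<close> as bimodules\<close>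
    bimodule (hscale C) (lact1 C) (ract1 C) \<and>
    (\<forall>t\<in>OmegaU1. \<forall>u. HH_eq C t u \<longrightarrow> proj1 C t = proj1 C u) \<and>
    (\<forall>t\<in>OmegaU1. \<forall>u\<in>OmegaU1. proj1 C (t + u) = proj1 C t + proj1 C u) \<and>
    (\<forall>h. \<forall>t\<in>OmegaU1. proj1 C (image_mset (\<lambda>(a, b). (h * a, b)) t) = lact1 C h (proj1 C t)) \<and>
    (\<forall>h. \<forall>t\<in>OmegaU1. proj1 C (image_mset (\<lambda>(a, b). (a, b * h)) t) = ract1 C (proj1 C t) h) \<and>
    proj1 C ` OmegaU1 = UNIV \<and>
    (\<forall>t\<in>OmegaU1. proj1 C t = 0 \<longleftrightarrow> t \<in> NH C)"

definition finite_dimensional :: "('k::field \<Rightarrow> 'v::ab_group_add \<Rightarrow> 'v) \<Rightarrow> bool" where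
  "finite_dimensional s \<longleftrightarrow> vector_space s \<and> (\<exists>B. finite B \<and> module.span s B = UNIV)"

definition scale1 :: "('k, 'h::ring_1, 'v, 'w, 'x, 'z) calculus_scheme \<Rightarrow> 'k \<Rightarrow> 'w \<Rightarrow> 'w" where
  "scale1 C c m = lact1 C (hscale C c 1) m"

text \<open>The projection \<open>proj0\<close> extended to all of \<open>H\<close> by first removing the counit part.\<close>

definition tproj0 :: "('k, 'h::ring_1, 'v, 'w, 'x, 'z) calculus_scheme \<Rightarrow> 'h \<Rightarrow> 'v" where
  "tproj0 C h = proj0 C (h - hscale C (counit C h) 1)"

definition lift0 :: "('k::zero, 'h, 'v, 'w, 'x, 'z) calculus_scheme \<Rightarrow> 'v \<Rightarrow> 'h" where
  "lift0 C v = (SOME h. h \<in> ker_counit C \<and> proj0 C h = v)"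

text \<open>
  \<open>Ad\<close> maps \<open>ker \<epsilon>\<close> to \<open>ker \<epsilon> \<otimes> H\<close>, but the members of a representing formal sum need not have
  first components in \<open>ker \<epsilon>\<close>; on \<open>ker \<epsilon> \<otimes> H\<close> the maps \<open>\<pi> \<otimes> id\<close> and \<open>tproj0 \<otimes> id\<close> agree.
\<close>

definition coact0 ::
  "('k::zero, 'h::ring_1, 'v, 'w, 'x, 'z) calculus_scheme \<Rightarrow> 'v \<Rightarrow> ('v \<times> 'h) multiset" where
  "coact0 C v = image_mset (\<lambda>(a, b). (tproj0 C a, b)) (Ad C (lift0 C v))"

definition act0 :: "('k::zero, 'h::ring_1, 'v, 'w, 'x, 'z) calculus_scheme \<Rightarrow> 'v \<Rightarrow> 'h \<Rightarrow> 'v" where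
  "act0 C v h = proj0 C (lift0 C v * h)"

definition Ssq0 :: "('k::zero, 'h, 'v, 'w, 'x, 'z) calculus_scheme \<Rightarrow> 'v \<Rightarrow> 'v" where
  "Ssq0 C v = proj0 C (antipode C (antipode C (lift0 C v)))"

definition extd0 :: "('k, 'h::ring_1, 'v, 'w, 'x, 'z) calculus_scheme \<Rightarrow> 'h \<Rightarrow> 'w" where
  "extd0 C h = proj1 C {#(1, h), (- h, 1)#}"

definition maurer_cartan :: "('k::zero, 'h, 'v, 'w, 'x, 'z) calculus_scheme \<Rightarrow> 'v \<Rightarrow> 'w" where
  "maurer_cartan C v = proj1 C (image_mset (\<lambda>(a, b). (antipode C a, b)) (comult C (lift0 C v)))"


section \<open>Two-forms\<close>

abbreviation (input) Omega11_eq where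
  "Omega11_eq C \<equiv> tensor_eq (ract1 C) (lact1 C)"

definition is_Psi ::
  "('k::zero, 'h::ring_1, 'v, 'w::ab_group_add, 'x, 'z) calculus_scheme \<Rightarrow> bool" where
  "is_Psi C \<longleftrightarrow>
    (\<forall>t u. Omega11_eq C t u \<longrightarrow> Omega11_eq C (Psi C t) (Psi C u)) \<and>
    (\<forall>t u. Omega11_eq C (Psi C (t + u)) (Psi C t + Psi C u)) \<and>
    (\<forall>h t. Omega11_eq C (Psi C (image_mset (\<lambda>(m, n). (lact1 C h m, n)) t))
      (image_mset (\<lambda>(m, n). (lact1 C h m, n)) (Psi C t))) \<and>
    (\<forall>h t. Omega11_eq C (Psi C (image_mset (\<lambda>(m, n). (m, ract1 C n h)) t))
      (image_mset (\<lambda>(m, n). (m, ract1 C n h)) (Psi C t))) \<and>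
    (\<forall>v. \<forall>g\<in>ker_counit C.
      Omega11_eq C (Psi C {#(maurer_cartan C v, maurer_cartan C (proj0 C g))#})
        (image_mset (\<lambda>(a, b, c).
            (maurer_cartan C (tproj0 C b), maurer_cartan C (act0 C v (antipode C a * c))))
          (comult2 C g)))"

text \<open>
  \<open>\<Omega>\<^sup>2(H)\<close> is the quotient of \<open>\<Omega>\<^sup>1(H) \<otimes>\<^sub>H \<Omega>\<^sup>1(H)\<close> by \<open>ker (id - \<Psi>)\<close>, and the exterior derivative
  is determined by \<open>d (h dg) = dh \<and> dg\<close>.
\<close>

definition two_forms ::
  "('k::zero, 'h::ring_1, 'v, 'w::ab_group_add, 'x::ab_group_add, 'z) calculus_scheme \<Rightarrow> bool" where
  "two_forms C \<longleftrightarrow>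
    is_Psi C \<and>
    bimodule (hscale C) (lact2 C) (ract2 C) \<and>
    (\<forall>m m' n. wedge C (m + m') n = wedge C m n + wedge C m' n) \<and>
    (\<forall>m n n'. wedge C m (n + n') = wedge C m n + wedge C m n') \<and>
    (\<forall>m h n. wedge C (ract1 C m h) n = wedge C m (lact1 C h n)) \<and>
    (\<forall>h m n. wedge C (lact1 C h m) n = lact2 C h (wedge C m n)) \<and>
    (\<forall>m n h. wedge C m (ract1 C n h) = ract2 C (wedge C m n) h) \<and>
    (\<forall>x. \<exists>t. x = (\<Sum>(m, n)\<in>#t. wedge C m n)) \<and>
    (\<forall>t. (\<Sum>(m, n)\<in>#t. wedge C m n) = 0 \<longleftrightarrow> Omega11_eq C t (Psi C t)) \<and>
    (\<forall>m n. extd C (m + n) = extd C m + extd C n) \<and>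
    (\<forall>h g. extd C (lact1 C h (extd0 C g)) = wedge C (extd0 C h) (extd0 C g))"


section \<open>Metrics, coframings and cotorsion\<close>

definition dual0 :: "('k::field, 'h, 'v::ab_group_add, 'w, 'x, 'z) calculus_scheme \<Rightarrow> ('v \<Rightarrow> 'k) set" where
  "dual0 C = {f. Vector_Spaces.linear (vscale C) (*) f}"

definition dual_scale :: "'k::times \<Rightarrow> ('v \<Rightarrow> 'k) \<Rightarrow> 'v \<Rightarrow> 'k" where
  "dual_scale c f = (\<lambda>v. c * f v)"

definition Ad_invariant ::
  "('k::zero, 'h::ring_1, 'v::ab_group_add, 'w, 'x, 'z) calculus_scheme \<Rightarrow> ('v \<times> 'v) multiset \<Rightarrow> bool" where
  "Ad_invariant C eta \<longleftrightarrow>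
    tensor3_eq (vscale C) (vscale C) (hscale C)
      (\<Sum>(x, y)\<in>#eta. \<Sum>(x0, x1)\<in>#coact0 C x. image_mset (\<lambda>(y0, y1). (x0, y0, x1 * y1)) (coact0 C y))
      (image_mset (\<lambda>(x, y). (x, y, 1)) eta)"

definition eta_map ::
  "('k, 'h, 'v::ab_group_add, 'w, 'x, 'z) calculus_scheme \<Rightarrow> ('v \<times> 'v) multiset \<Rightarrow> ('v \<Rightarrow> 'k) \<Rightarrow> 'v" where
  "eta_map C eta f = (\<Sum>(x, y)\<in>#eta. vscale C (f y) x)"

definition nondegenerate ::
  "('k::field, 'h, 'v::ab_group_add, 'w, 'x, 'z) calculus_scheme \<Rightarrow> ('v \<times> 'v) multiset \<Rightarrow> bool" where
  "nondegenerate C eta \<longleftrightarrow> bij_betw (eta_map C eta) (dual0 C) UNIV"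

text \<open>
  A linear map on \<open>\<Omega>\<^sub>0\<^sup>*\<close> whose induced map \<open>\<Omega>\<^sub>0\<^sup>* \<otimes> H \<rightarrow> \<Omega>\<^sup>1(H)\<close>, \<open>f \<otimes> h \<mapsto> E f h\<close>, is
  surjective and injective.
\<close>

definition coframing ::
  "('k::field, 'h::ring_1, 'v::ab_group_add, 'w::ab_group_add, 'x, 'z) calculus_scheme
    \<Rightarrow> (('v \<Rightarrow> 'k) \<Rightarrow> 'w) \<Rightarrow> bool" where
  "coframing C E \<longleftrightarrow>
    (\<forall>f\<in>dual0 C. \<forall>f'\<in>dual0 C. E (f + f') = E f + E f') \<and>
    (\<forall>c. \<forall>f\<in>dual0 C. E (dual_scale c f) = scale1 C c (E f)) \<and>
    (\<forall>m. \<exists>t. set_mset t \<subseteq> dual0 C \<times> UNIV \<and> m = (\<Sum>(f, h)\<in>#t. ract1 C (E f) h)) \<and>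
    (\<forall>t u. set_mset t \<subseteq> dual0 C \<times> UNIV \<longrightarrow> set_mset u \<subseteq> dual0 C \<times> UNIV \<longrightarrow>
      (\<Sum>(f, h)\<in>#t. ract1 C (E f) h) = (\<Sum>(f, h)\<in>#u. ract1 C (E f) h) \<longrightarrow>
      tensor_eq_on (dual0 C) UNIV (\<lambda>f c. dual_scale c f) (hscale C) t u)"

definition dual_bases ::
  "('k::field, 'h, 'v::ab_group_add, 'w, 'x, 'z) calculus_scheme \<Rightarrow> 'v set \<Rightarrow> ('v \<Rightarrow> 'v \<Rightarrow> 'k) \<Rightarrow> bool" where
  "dual_bases C B F \<longleftrightarrow>
    finite B \<and> \<not> module.dependent (vscale C) B \<and> module.span (vscale C) B = UNIV \<and>
    (\<forall>b\<in>B. F b \<in> dual0 C \<and> (\<forall>b'\<in>B. F b b' = (if b = b' then 1 else 0)))"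

definition metric ::
  "('k::zero, 'h, 'v, 'w, 'x, 'z) calculus_scheme
    \<Rightarrow> (('v \<Rightarrow> 'k) \<Rightarrow> 'w) \<Rightarrow> 'v set \<Rightarrow> ('v \<Rightarrow> 'v \<Rightarrow> 'k) \<Rightarrow> ('w \<times> 'w) multiset" where
  "metric C E B F = image_mset (\<lambda>b. (E (F b), maurer_cartan C b)) (mset_set B)"

definition wedge_quotient ::
  "('k, 'h, 'v, 'w, 'x::ab_group_add, 'z) calculus_scheme \<Rightarrow> ('w \<times> 'w) multiset \<Rightarrow> 'x" where
  "wedge_quotient C t = (\<Sum>(m, n)\<in>#t. wedge C m n)"

definition dual_coact ::
  "('k::field, 'h::ring_1, 'v::ab_group_add, 'w, 'x, 'z) calculus_scheme
    \<Rightarrow> ('v \<Rightarrow> 'k) \<Rightarrow> (('v \<Rightarrow> 'k) \<times> 'h) multiset" where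
  "dual_coact C f = (SOME t. set_mset t \<subseteq> dual0 C \<times> UNIV \<and>
    (\<forall>v. (\<Sum>(f0, f1)\<in>#t. hscale C (f0 v) f1) =
         (\<Sum>(v0, v1)\<in>#coact0 C v. hscale C (f v0) (inv (antipode C) v1))))"

definition gauge_field ::
  "('k::field, 'h::ring_1, 'v::ab_group_add, 'w::ab_group_add, 'x, 'z) calculus_scheme
    \<Rightarrow> ('v \<Rightarrow> 'w) \<Rightarrow> bool" where
  "gauge_field C A \<longleftrightarrow> Vector_Spaces.linear (vscale C) (scale1 C) A"

definition D_coframe ::
  "('k::field, 'h::ring_1, 'v::ab_group_add, 'w, 'x::ab_group_add, 'z) calculus_scheme
    \<Rightarrow> ('v \<Rightarrow> 'w) \<Rightarrow> (('v \<Rightarrow> 'k) \<Rightarrow> 'w) \<Rightarrow> ('v \<Rightarrow> 'k) \<Rightarrow> 'x" where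
  "D_coframe C A E f =
    extd C (E f) + (\<Sum>(f0, f1)\<in>#dual_coact C f. wedge C (E f0) (A (tproj0 C f1)))"

definition cotorsion ::
  "('k::field, 'h::ring_1, 'v::ab_group_add, 'w, 'x::ab_group_add, 'z) calculus_scheme
    \<Rightarrow> ('v \<Rightarrow> 'w) \<Rightarrow> (('v \<Rightarrow> 'k) \<Rightarrow> 'w) \<Rightarrow> 'v set \<Rightarrow> ('v \<Rightarrow> 'v \<Rightarrow> 'k) \<Rightarrow> ('x \<times> 'w) multiset" where
  "cotorsion C A E B F = image_mset (\<lambda>b. (D_coframe C A E (F b), maurer_cartan C b)) (mset_set B)"

text \<open>
  The formula for \<open>D\<^sub>A e\<close> at the class of \<open>g \<in> ker \<epsilon>\<close>, with \<open>g\<close> as the lift.  The map \<open>D\<^sub>A e\<close>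
  itself uses a chosen lift; that the choice is irrelevant is part of the theorem.
\<close>

definition D_frame_lift ::
  "('k::zero, 'h::ring_1, 'v::ab_group_add, 'w, 'x::ab_group_add, 'z) calculus_scheme
    \<Rightarrow> ('v \<Rightarrow> 'w) \<Rightarrow> 'h \<Rightarrow> 'x" where
  "D_frame_lift C A g =
    extd C (maurer_cartan C (proj0 C g)) +
    (\<Sum>(a, b, c)\<in>#comult2 C g.
      wedge C (maurer_cartan C (tproj0 C b)) (A (tproj0 C (antipode C a * c))))"

definition D_frame ::
  "('k::zero, 'h::ring_1, 'v::ab_group_add, 'w, 'x::ab_group_add, 'z) calculus_scheme
    \<Rightarrow> ('v \<Rightarrow> 'w) \<Rightarrow> 'v \<Rightarrow> 'x" where
  "D_frame C A v = D_frame_lift C A (lift0 C v)"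

end

(*
  The map h (x) v -> h e(v) identifies Omega^1(H) with the free left H-module on Omega_0, and
  e(v) h = h_1 e(v . h_2), with inverse h e(v) = e(v . S^-1 h_2) h_1, so Omega^1(H) is also free as
  a right module on e(Omega_0); hence e o eta is a coframing.  Ad-invariance of eta gives
    eta^1 (x) eta^2_0 (x) eta^2_1 = eta^1_0 (x) eta^2 (x) S(eta^1_1).
  Together with v_0 . S(v_1) = S^2 v it turns Psi(g) into e(eta^2) (x) e(S^2 eta^1), and since
  e (x)_H e is injective on Omega_0 (x) Omega_0, g is fixed by Psi exactly when
  eta^1 (x) eta^2 = eta^2 (x) S^2 eta^1.  Applying S^-1 to the last leg of the same identity says
  that eta intertwines the coactions of Omega_0^* and Omega_0, which gives the cotorsion.
*)
theory Submission
  imports Defs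
begin

section \<open>Formal sums and tensors\<close>

text \<open>One-forms are known only as a quotient with kernel N_H, so two of them are separated by
  constructing additive maps out of Omega^1(H). These arise from h \<otimes> g |-> G(h g_1, pi g_2),
  which vanishes on N_H, and every injectivity claim, for the coframing as for e \<otimes> e, rests
  on them. A tensor is a class of formal sums, and coproducts, coactions and \<open>Psi\<close>
  merely choose representatives. A Sweedler sum is independent of the choice when its summand is
  linear in each leg; hence the linearity side conditions throughout. Tensor equations are used by
  evaluating balanced maps on them and mostly proved by comparing coordinates in a basis, which
  moves the computations into ordinary modules. The coproduct legs of an element of ker \<epsilon>
  need not lie in ker \<epsilon>, so the projection to Omega_0 and S(g_1) dg_2 are extended to all
  of H so as to kill 1.\<close>

lemma additive_congruence_add:
  "additive_congruence R t u \<Longrightarrow> additive_congruence R t' u'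
    \<Longrightarrow> additive_congruence R (t + t') (u + u')"
  by (metis additive_congruence.add additive_congruence.trans add.commute)

lemma additive_congruence_sum:
  "(\<And>p. p \<in># t \<Longrightarrow> additive_congruence R (F p) (G p))
    \<Longrightarrow> additive_congruence R (\<Sum>p\<in>#t. F p) (\<Sum>p\<in>#t. G p)"
  by (induction t) (auto intro: additive_congruence.refl additive_congruence_add)

text \<open>A map of formal sums descends to classes once it respects the generating relations; the
  target may itself be a tensor product.\<close>

lemma additive_congruence_lift:
  assumes "additive_congruence R t u"
    and "\<And>t u. R t u \<Longrightarrow> additive_congruence R' (\<Sum>p\<in>#t. F p) (\<Sum>p\<in>#u. F p)"
  shows "additive_congruence R' (\<Sum>p\<in>#t. F p) (\<Sum>p\<in>#u. F p)"
  using assms(1)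
  by induction (auto intro: additive_congruence.intros assms(2))

lemma additive_congruence_sum_eq:
  fixes f :: "'p \<Rightarrow> 'm::comm_monoid_add"
  assumes "additive_congruence R t u"
    and "\<And>t u. R t u \<Longrightarrow> (\<Sum>p\<in>#t. f p) = (\<Sum>p\<in>#u. f p)"
  shows "(\<Sum>p\<in>#t. f p) = (\<Sum>p\<in>#u. f p)"
  using assms(1) by induction (auto simp: assms(2))

lemma sum_mset_sum_mset:
  fixes f :: "'p \<Rightarrow> 'm::comm_monoid_add"
  shows "(\<Sum>p\<in>#(\<Sum>q\<in>#t. G q). f p) = (\<Sum>q\<in>#t. \<Sum>p\<in>#G q. f p)"
  by (induction t) simp_all

lemma tensor_eq_zero_left: "tensor_eq_on M UNIV ra la {#(0, n)#} {#}"
  by (intro additive_congruence.base tensor_relation.zero) simp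

lemma tensor_eq_add_left:
  "m \<in> M \<Longrightarrow> m' \<in> M \<Longrightarrow> tensor_eq_on M UNIV ra la {#(m + m', n)#} {#(m, n), (m', n)#}"
  by (intro additive_congruence.base tensor_relation.add_left) simp_all

lemma tensor_eq_add_right:
  "m \<in> M \<Longrightarrow> tensor_eq_on M UNIV ra la {#(m, n + n')#} {#(m, n), (m, n')#}"
  by (intro additive_congruence.base tensor_relation.add_right) simp_all

lemma tensor_eq_negative_left:
  assumes "m \<in> M" "- m \<in> M"
  shows "tensor_eq_on M UNIV ra la {#(m, n), (- m, n)#} {#}"
  using tensor_eq_add_left[OF assms, of ra la n] tensor_eq_zero_left[of M ra la n]
  by (simp) (blast intro: additive_congruence.sym additive_congruence.trans)

text \<open>Only 0 \<otimes> n = 0 is a defining relation. In m \<otimes> 0 = m \<otimes> 0 + m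
  \<otimes> 0 one copy is cancelled by adding (-m) \<otimes> 0.\<close>

lemma tensor_eq_zero_right:
  assumes "m \<in> M" "- m \<in> M"
  shows "tensor_eq_on M UNIV ra la {#(m, 0)#} {#}"
proof -
  let ?E = "tensor_eq_on M UNIV ra la"
  have 1: "?E {#(m, 0), (- m, 0)#} {#}"
    using assms by (rule tensor_eq_negative_left)
  have 2: "?E {#(m, 0)#} {#(m, 0), (m, 0)#}"
    using tensor_eq_add_right[of m M ra la 0 0] assms by simp
  have "?E ({#(m, 0)#} + {#(- m, 0)#}) ({#(m, 0), (m, 0)#} + {#(- m, 0)#})"
    using 2 by (rule additive_congruence.add)
  moreover have "?E ({#(m, 0), (- m, 0)#} + {#(m, 0)#}) ({#} + {#(m, 0)#})"
    using 1 by (rule additive_congruence.add)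
  ultimately show ?thesis
    using 1 by (simp add: add_mset_commute) (blast intro: additive_congruence.sym additive_congruence.trans)
qed

lemma tensor_eq_sum_right:
  assumes "m \<in> M" "- m \<in> M"
  shows "tensor_eq_on M UNIV ra la {#(m, \<Sum>i\<in>#I. f i)#} (image_mset (\<lambda>i. (m, f i)) I)"
proof (induction I)
  case empty
  show ?case using tensor_eq_zero_right[OF assms] by simp
next
  case (add i I)
  have "tensor_eq_on M UNIV ra la {#(m, f i + (\<Sum>i\<in>#I. f i))#} ({#(m, f i)#} + {#(m, \<Sum>i\<in>#I. f i)#})"
    using tensor_eq_add_right[OF assms(1)] by (simp add: add_mset_commute)
  then show ?case
    using additive_congruence_add[OF additive_congruence.refl add, of "{#(m, f i)#}"]
    by (simp add: add_mset_commute) (blast intro: additive_congruence.trans)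
qed

lemma tensor_eq_sum_left:
  assumes M: "0 \<in> M" "\<And>x y. x \<in> M \<Longrightarrow> y \<in> M \<Longrightarrow> x + y \<in> M"
    and "\<And>i. i \<in># I \<Longrightarrow> f i \<in> M"
  shows "tensor_eq_on M UNIV ra la {#(\<Sum>i\<in>#I. f i, n)#} (image_mset (\<lambda>i. (f i, n)) I)"
  using assms(3)
proof (induction I)
  case empty
  show ?case using tensor_eq_zero_left by simp
next
  case (add i I)
  have IM: "(\<Sum>i\<in>#I. f i) \<in> M" using add.prems
    by (induction I) (auto intro: M)
  have "tensor_eq_on M UNIV ra la {#(f i + (\<Sum>i\<in>#I. f i), n)#} ({#(f i, n)#} + {#(\<Sum>i\<in>#I. f i, n)#})"
    using tensor_eq_add_left[OF add.prems IM, of i] by (simp add: add_mset_commute)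
  then show ?case
    using additive_congruence_add[OF additive_congruence.refl add.IH, of "{#(f i, n)#}"] add.prems
    by (simp add: add_mset_commute) (blast intro: additive_congruence.trans)
qed

text \<open>A normal form: expanding the left leg in the generators \<open>u b\<close> and moving
  the coefficients across leaves one right leg for each b.\<close>

lemma tensor_eq_coordinates:
  assumes M: "0 \<in> M" "\<And>x y. x \<in> M \<Longrightarrow> y \<in> M \<Longrightarrow> x + y \<in> M" "\<And>x. x \<in> M \<Longrightarrow> - x \<in> M"
    "\<And>x c. x \<in> M \<Longrightarrow> ra x c \<in> M"
    and u: "\<And>b. b \<in> B \<Longrightarrow> u b \<in> M"
    and exp: "\<And>m. m \<in> M \<Longrightarrow> m = (\<Sum>b\<in>B. ra (u b) (c b m))"
    and fin: "finite B"
    and t: "set_mset t \<subseteq> M \<times> UNIV"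
  shows "tensor_eq_on M UNIV ra la t
    (image_mset (\<lambda>b. (u b, \<Sum>(m, n)\<in>#t. la (c b m) n)) (mset_set B))"
proof -
  let ?E = "tensor_eq_on M UNIV ra la"
  let ?B = "mset_set B"
  have 1: "?E {#p#} (\<Sum>b\<in>#?B. {#(u b, la (c b (fst p)) (snd p))#})" if "p \<in># t" for p
  proof -
    obtain m n where p: "p = (m, n)" by force
    then have m: "m \<in> M" using t that by auto
    have "m = (\<Sum>b\<in>#?B. ra (u b) (c b m))"
      using exp[OF m] by (simp add: sum_unfold_sum_mset)
    then have "?E {#(m, n)#} (image_mset (\<lambda>b. (ra (u b) (c b m), n)) ?B)"
      using tensor_eq_sum_left[of M ?B "\<lambda>b. ra (u b) (c b m)" ra la n, OF M(1,2)] M(4) u fin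
      by auto
    moreover have "?E (\<Sum>b\<in>#?B. {#(ra (u b) (c b m), n)#}) (\<Sum>b\<in>#?B. {#(u b, la (c b m) n)#})"
      using u fin by (intro additive_congruence_sum additive_congruence.base tensor_relation.balanced) auto
    ultimately show ?thesis unfolding p by (simp) (blast intro: additive_congruence.trans)
  qed
  have "?E (\<Sum>p\<in>#t. {#p#}) (\<Sum>p\<in>#t. \<Sum>b\<in>#?B. {#(u b, la (c b (fst p)) (snd p))#})"
    using 1 by (rule additive_congruence_sum)
  then have 2: "?E t (\<Sum>b\<in>#?B. \<Sum>p\<in>#t. {#(u b, la (c b (fst p)) (snd p))#})"
    by (subst sum_mset.swap) simp
  have "?E (\<Sum>b\<in>#?B. {#(u b, \<Sum>(m, n)\<in>#t. la (c b m) n)#})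
      (\<Sum>b\<in>#?B. \<Sum>p\<in>#t. {#(u b, la (c b (fst p)) (snd p))#})"
    using tensor_eq_sum_right[of _ M ra la _ t] u fin M(3)
    by (intro additive_congruence_sum) (auto simp: case_prod_unfold)
  then show ?thesis
    using 2 by simp (blast intro: additive_congruence.sym additive_congruence.trans)
qed

text \<open>Equal coordinates give equal normal forms. The left factor is a carrier set because the
  dual of Omega_0 is only a subset of its function type.\<close>

lemma tensor_eq_onI_coordinates:
  assumes "0 \<in> M" "\<And>x y. x \<in> M \<Longrightarrow> y \<in> M \<Longrightarrow> x + y \<in> M" "\<And>x. x \<in> M \<Longrightarrow> - x \<in> M"
    "\<And>x c. x \<in> M \<Longrightarrow> ra x c \<in> M"
    and "\<And>b. b \<in> B \<Longrightarrow> u b \<in> M"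
    and "\<And>m. m \<in> M \<Longrightarrow> m = (\<Sum>b\<in>B. ra (u b) (c b m))"
    and fin: "finite B"
    and "set_mset t \<subseteq> M \<times> UNIV" "set_mset t' \<subseteq> M \<times> UNIV"
    and eq: "\<And>b. b \<in> B \<Longrightarrow> (\<Sum>(m, n)\<in>#t. la (c b m) n) = (\<Sum>(m, n)\<in>#t'. la (c b m) n)"
  shows "tensor_eq_on M UNIV ra la t t'"
proof -
  have "image_mset (\<lambda>b. (u b, \<Sum>(m, n)\<in>#t. la (c b m) n)) (mset_set B) =
      image_mset (\<lambda>b. (u b, \<Sum>(m, n)\<in>#t'. la (c b m) n)) (mset_set B)"
    using fin by (intro image_mset_cong) (simp add: eq)
  then show ?thesis
    using tensor_eq_coordinates[OF assms(1-7), where t = t and la = la]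
      tensor_eq_coordinates[OF assms(1-7), where t = t' and la = la] assms(8,9)
    by (metis (no_types, lifting) additive_congruence.sym additive_congruence.trans)
qed

lemma tensor_eq_sum_eq:
  fixes F :: "'m::ab_group_add \<Rightarrow> 'n::ab_group_add \<Rightarrow> 'p::ab_group_add"
  assumes "tensor_eq ra la t u"
    and "\<And>m m' n. F (m + m') n = F m n + F m' n"
    and "\<And>m n n'. F m (n + n') = F m n + F m n'"
    and "\<And>m r n. F (ra m r) n = F m (la r n)"
  shows "(\<Sum>(m, n)\<in>#t. F m n) = (\<Sum>(m, n)\<in>#u. F m n)"
proof (rule additive_congruence_sum_eq[OF assms(1)])
  fix t u :: "('m \<times> 'n) multiset"
  assume "tensor_relation UNIV UNIV ra la t u"
  moreover have "F 0 n = 0" for n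
    using assms(2)[of 0 0 n] by simp
  ultimately show "(\<Sum>(m, n)\<in>#t. F m n) = (\<Sum>(m, n)\<in>#u. F m n)"
    by cases (auto simp: assms)
qed

text \<open>Formal sums have no subtraction, so cancellation goes through an inverse up to
  congruence.\<close>

lemma additive_congruence_cancel:
  assumes "\<And>t. \<exists>u. additive_congruence R (t + u) {#}"
    and "additive_congruence R (t + v) t"
  shows "additive_congruence R v {#}"
proof -
  obtain u where u: "additive_congruence R (t + u) {#}" using assms(1) by blast
  have "additive_congruence R (t + v + u) (t + u)"
    using assms(2) by (rule additive_congruence.add)
  moreover have "additive_congruence R (t + u + v) ({#} + v)"
    using u by (rule additive_congruence.add)
  ultimately show ?thesis
    using u by (simp add: ac_simps) (blast intro: additive_congruence.sym additive_congruence.trans)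
qed

lemma tensor_eq_negative:
  "\<exists>u. tensor_eq ra la (t + u) {#}"
proof
  let ?u = "image_mset (\<lambda>(m, n). (- m, n)) t"
  have "tensor_eq ra la {#(m, n), (- m, n)#} {#}" for m n
    by (rule tensor_eq_negative_left) simp_all
  then have "tensor_eq ra la (\<Sum>p\<in>#t. {#p, (- fst p, snd p)#}) (\<Sum>p\<in>#t. {#})"
    by (intro additive_congruence_sum) auto
  moreover have "(\<Sum>p\<in>#t. {#p, (- fst p, snd p)#}) = t + ?u"
    by (induction t) (auto simp: case_prod_unfold)
  ultimately show "tensor_eq ra la (t + ?u) {#}"
    by simp
qed

section \<open>Sweedler calculus in a Hopf algebra\<close>

text \<open>
  Every variable occurs exactly once in a Sweedler expression, so these rules, applied backwards
  with \<open>intro\<close>, reduce linearity in that variable to that of the atoms.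
\<close>

named_theorems linear_rules

lemma linear_add: "Vector_Spaces.linear r t f \<Longrightarrow> f (x + y) = f x + f y"
  by (simp add: Vector_Spaces.linear_iff)

lemma linear_scale: "Vector_Spaces.linear r t f \<Longrightarrow> f (r c x) = t c (f x)"
  by (simp add: Vector_Spaces.linear_iff)

lemma linear_zero: "Vector_Spaces.linear r t f \<Longrightarrow> f 0 = 0"
  by (metis add_cancel_left_left linear_add)

lemma linear_diff: "Vector_Spaces.linear r t f \<Longrightarrow> f (x - y) = f x - f y"
  by (metis add_diff_cancel diff_add_cancel linear_add)

lemma linear_sum_mset:
  "Vector_Spaces.linear r t f \<Longrightarrow> f (\<Sum>x\<in>#I. F x) = (\<Sum>x\<in>#I. f (F x))"
  by (induction I) (simp_all add: linear_add linear_zero)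

lemma linear_comp:
  "Vector_Spaces.linear s t g \<Longrightarrow> Vector_Spaces.linear r s f \<Longrightarrow> Vector_Spaces.linear r t (\<lambda>x. g (f x))"
  by (simp add: Vector_Spaces.linear_iff)

lemma linear_sum_mset_body:
  assumes "\<And>i. Vector_Spaces.linear r t (\<lambda>x. F x i)"
  shows "Vector_Spaces.linear r t (\<lambda>x. \<Sum>i\<in>#I. F x i)"
proof -
  interpret r: vector_space r using assms by (simp add: Vector_Spaces.linear_iff)
  interpret t: vector_space t using assms by (simp add: Vector_Spaces.linear_iff)
  show ?thesis
    by (induction I) (use assms in \<open>simp_all add: Vector_Spaces.linear_iff r.vector_space_axioms
      t.vector_space_axioms t.scale_right_distrib\<close>)
qed

lemma vector_space_field: "vector_space ((*) :: 'k::field \<Rightarrow> 'k \<Rightarrow> 'k)"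
  by unfold_locales (simp_all add: algebra_simps)

lemma linear_field_id [linear_rules]: "Vector_Spaces.linear (*) (*) (\<lambda>x::'k::field. x)"
  by (simp add: Vector_Spaces.linear_iff vector_space_field)

text \<open>The coproduct is a chosen formal sum, so the value is intrinsic when \<open>F\<close> is
  bilinear. The curried form lets nested sums stand for h_1, h_2, h_3.\<close>

definition sweedler ::
  "('k, 'h, 'z) hopf_scheme \<Rightarrow> 'h \<Rightarrow> ('h \<Rightarrow> 'h \<Rightarrow> 'm::comm_monoid_add) \<Rightarrow> 'm" where
  "sweedler C h F = (\<Sum>(a, b)\<in>#comult C h. F a b)"

locale hopf =
  fixes C :: "('k::field, 'h::ring_1, 'z) hopf_scheme"
  assumes hopf: "hopf_algebra C"
begin

abbreviation sH where "sH \<equiv> hscale C"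
abbreviation S where "S \<equiv> antipode C"
abbreviation \<epsilon> where "\<epsilon> \<equiv> counit C"
abbreviation sw :: "'h \<Rightarrow> ('h \<Rightarrow> 'h \<Rightarrow> 'm::comm_monoid_add) \<Rightarrow> 'm" where "sw \<equiv> sweedler C"

sublocale H: vector_space sH
  using hopf by (simp add: hopf_algebra_def)

lemma scale_mult: "sH c x * y = sH c (x * y)" "x * sH c y = sH c (x * y)"
proof -
  have "\<forall>c x y. sH c (x * y) = sH c x * y \<and> sH c (x * y) = x * sH c y"
    using hopf unfolding hopf_algebra_def by blast
  then show "sH c x * y = sH c (x * y)" "x * sH c y = sH c (x * y)" by metis+
qed

lemma counit_linear: "Vector_Spaces.linear sH (*) \<epsilon>"
  and antipode_linear: "Vector_Spaces.linear sH sH S"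
  using hopf by (simp_all add: hopf_algebra_def)

lemma counit_mult [simp]: "\<epsilon> (x * y) = \<epsilon> x * \<epsilon> y"
  and counit_one [simp]: "\<epsilon> 1 = 1"
  using hopf by (simp_all add: hopf_algebra_def)

lemma counit_diff [simp]: "\<epsilon> (x - y) = \<epsilon> x - \<epsilon> y"
  and counit_scale [simp]: "\<epsilon> (sH c x) = c * \<epsilon> x"
  and counit_zero [simp]: "\<epsilon> 0 = 0"
  and counit_add [simp]: "\<epsilon> (x + y) = \<epsilon> x + \<epsilon> y"
  using counit_linear by (auto simp: linear_diff linear_scale linear_add dest: linear_zero)

lemma sweedler_sum_eq:
  assumes "ktensor_eq sH sH t u"
    and "\<And>y. Vector_Spaces.linear sH r (\<lambda>x. F x y)" "\<And>x. Vector_Spaces.linear sH r (F x)"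
  shows "(\<Sum>(a, b)\<in>#t. F a b) = (\<Sum>(a, b)\<in>#u. F a b)"
  by (rule tensor_eq_sum_eq[OF assms(1)])
    (simp_all add: linear_add[OF assms(2)] linear_add[OF assms(3)]
      linear_scale[OF assms(2)] linear_scale[OF assms(3)])

lemma tensor3_sum_eq:
  assumes "tensor3_eq s1 s2 s3 t u"
    and F: "\<And>y z. Vector_Spaces.linear s1 r (\<lambda>x. F x y z)"
    "\<And>x z. Vector_Spaces.linear s2 r (\<lambda>y. F x y z)" "\<And>x y. Vector_Spaces.linear s3 r (F x y)"
  shows "(\<Sum>(a, b, c)\<in>#t. F a b c) = (\<Sum>(a, b, c)\<in>#u. F a b c)"
proof (rule additive_congruence_sum_eq[OF assms(1)])
  fix t u assume "tensor3_relation s1 s2 s3 t u"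
  then show "(\<Sum>(a, b, c)\<in>#t. F a b c) = (\<Sum>(a, b, c)\<in>#u. F a b c)"
    by cases (simp_all add: linear_add[OF F(1)] linear_add[OF F(2)] linear_add[OF F(3)]
        linear_scale[OF F(1)] linear_scale[OF F(2)] linear_scale[OF F(3)] linear_zero[OF F(1)])
qed

lemma sweedler_linear: "Vector_Spaces.linear r t f \<Longrightarrow> f (sw h F) = sw h (\<lambda>a b. f (F a b))"
  by (simp add: sweedler_def linear_sum_mset case_prod_unfold)

lemma sweedler_swap:
  "sw h (\<lambda>a b. sw g (\<lambda>c d. F a b c d)) = sw g (\<lambda>c d. sw h (\<lambda>a b. F a b c d))"
  unfolding sweedler_def case_prod_unfold by (rule sum_mset.swap)

lemma sweedler_mult_left:
  fixes F :: "'h \<Rightarrow> 'h \<Rightarrow> 'h"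
  shows "sw h (\<lambda>a b. F a b * c) = sw h F * c"
  by (simp add: sweedler_def sum_mset_distrib_right case_prod_unfold)

lemma sweedler_mult_right:
  fixes F :: "'h \<Rightarrow> 'h \<Rightarrow> 'h"
  shows "sw h (\<lambda>a b. c * F a b) = c * sw h F"
  by (simp add: sweedler_def sum_mset_distrib_left case_prod_unfold)

lemma sweedler_scaleH: "sw h (\<lambda>a b. sH c (F a b)) = sH c (sw h F)"
  by (rule sweedler_linear[symmetric, where r = sH and t = sH]) (simp add: Vector_Spaces.linear_iff
    H.vector_space_axioms H.scale_right_distrib mult.commute)

lemma sweedler_add: "sw h (\<lambda>a b. F a b + G a b) = sw h F + sw h G"
  by (simp add: sweedler_def sum_mset.distrib case_prod_unfold)

text \<open>The coproduct of a sum is only congruent to the sum of the coproducts; bilinearity of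
  \<open>F\<close> turns the congruence into an equality of values.\<close>

lemma sweedler_linear_arg:
  assumes F: "\<And>y. Vector_Spaces.linear sH r (\<lambda>x. F x y)" "\<And>x. Vector_Spaces.linear sH r (F x)"
  shows "Vector_Spaces.linear sH r (\<lambda>h. sw h F)"
proof -
  interpret r: vector_space r using F by (simp add: Vector_Spaces.linear_iff)
  have scale_sum: "r c (\<Sum>p\<in>#t. f p) = (\<Sum>p\<in>#t. r c (f p))" for c t and f :: "'h \<times> 'h \<Rightarrow> _"
    by (induction t) (simp_all add: r.scale_right_distrib)
  have "sw (x + y) F = sw x F + sw y F" for x y
    unfolding sweedler_def
    by (subst sweedler_sum_eq[OF _ F, of "comult C (x + y)" "comult C x + comult C y"])
      (use hopf in \<open>simp_all add: hopf_algebra_def\<close>)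
  moreover have "sw (sH c x) F = r c (sw x F)" for c x
  proof -
    have "sw (sH c x) F = (\<Sum>(a, b)\<in>#image_mset (\<lambda>(a, b). (sH c a, b)) (comult C x). F a b)"
      unfolding sweedler_def
      by (rule sweedler_sum_eq[OF _ F]) (use hopf in \<open>simp_all add: hopf_algebra_def\<close>)
    also have "\<dots> = sw x (\<lambda>a b. r c (F a b))"
      by (simp add: sweedler_def image_mset.compositionality comp_def case_prod_unfold linear_scale[OF F(1)])
    also have "\<dots> = r c (sw x F)"
      unfolding sweedler_def case_prod_unfold scale_sum ..
    finally show ?thesis .
  qed
  ultimately show ?thesis
    by (simp add: Vector_Spaces.linear_iff H.vector_space_axioms r.vector_space_axioms)
qed

lemma linear_sweedler [linear_rules]:
  assumes f: "Vector_Spaces.linear q sH f"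
    and F: "\<And>y. Vector_Spaces.linear sH r (\<lambda>x. F x y)" "\<And>x. Vector_Spaces.linear sH r (\<lambda>y. F x y)"
  shows "Vector_Spaces.linear q r (\<lambda>x. sw (f x) F)"
  using linear_comp[OF sweedler_linear_arg[OF F] f] .

lemma linear_sweedler_body [linear_rules]:
  assumes "\<And>a b. Vector_Spaces.linear q r (\<lambda>x. F x a b)"
  shows "Vector_Spaces.linear q r (\<lambda>x. sw h (F x))"
  using assms unfolding sweedler_def case_prod_unfold by (rule linear_sum_mset_body)

lemma linear_id [linear_rules]: "Vector_Spaces.linear sH sH (\<lambda>x. x)"
  by (simp add: Vector_Spaces.linear_iff H.vector_space_axioms)

lemma linear_mult [linear_rules]:
  assumes "Vector_Spaces.linear q sH f"
  shows "Vector_Spaces.linear q sH (\<lambda>x. f x * c)" "Vector_Spaces.linear q sH (\<lambda>x. c * f x)"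
  using assms by (simp_all add: Vector_Spaces.linear_iff algebra_simps scale_mult)

lemma linear_antipode [linear_rules]:
  "Vector_Spaces.linear q sH f \<Longrightarrow> Vector_Spaces.linear q sH (\<lambda>x. S (f x))"
  by (rule linear_comp[OF antipode_linear])

lemma linear_counit [linear_rules]:
  "Vector_Spaces.linear q sH f \<Longrightarrow> Vector_Spaces.linear q (*) (\<lambda>x. \<epsilon> (f x))"
  by (rule linear_comp[OF counit_linear])

lemma linear_scaleH [linear_rules]:
  "Vector_Spaces.linear q sH f \<Longrightarrow> Vector_Spaces.linear q sH (\<lambda>x. sH c (f x))"
  "Vector_Spaces.linear q (*) g \<Longrightarrow> Vector_Spaces.linear q sH (\<lambda>x. sH (g x) h)"
  by (simp_all add: Vector_Spaces.linear_iff algebra_simps H.scale_left_distrib H.scale_right_distrib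
    H.vector_space_axioms)

lemma coassoc:
  assumes F: "\<And>y z. Vector_Spaces.linear sH r (\<lambda>x. F x y z)"
    "\<And>x z. Vector_Spaces.linear sH r (\<lambda>y. F x y z)" "\<And>x y. Vector_Spaces.linear sH r (\<lambda>z. F x y z)"
  shows "sw h (\<lambda>x c. sw x (\<lambda>a b. F a b c)) = sw h (\<lambda>a y. sw y (\<lambda>b c. F a b c))"
proof -
  let ?t = "\<Sum>(a, b)\<in>#comult C h. image_mset (\<lambda>(a1, a2). (a1, a2, b)) (comult C a)"
  have "(\<Sum>(a, b, c)\<in>#?t. F a b c) = (\<Sum>(a, b, c)\<in>#comult2 C h. F a b c)"
    by (rule tensor3_sum_eq[OF _ F]) (use hopf in \<open>simp add: hopf_algebra_def\<close>)
  then show ?thesis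
    unfolding comult2_def sweedler_def case_prod_unfold sum_mset_sum_mset
    by (simp add: image_mset.compositionality comp_def)
qed

lemma sum_comult2: "(\<Sum>(a, b, c)\<in>#comult2 C h. F a b c) = sw h (\<lambda>a y. sw y (\<lambda>b c. F a b c))"
proof -
  show ?thesis
    unfolding comult2_def sweedler_def case_prod_unfold sum_mset_sum_mset
    by (simp add: image_mset.compositionality comp_def)
qed

lemma sum_Ad: "(\<Sum>(a, b)\<in>#Ad C h. F a b) = sw h (\<lambda>a y. sw y (\<lambda>b c. F b (S a * c)))"
  using sum_comult2[of "\<lambda>a b c. F b (S a * c)" h]
  by (simp add: Ad_def image_mset.compositionality comp_def case_prod_unfold)

lemma counit_left: "sw h (\<lambda>a b. sH (\<epsilon> a) b) = h"
  and counit_right: "sw h (\<lambda>a b. sH (\<epsilon> b) a) = h"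
  and antipode_left: "sw h (\<lambda>a b. S a * b) = sH (\<epsilon> h) 1"
  and antipode_right: "sw h (\<lambda>a b. a * S b) = sH (\<epsilon> h) 1"
  using hopf by (simp_all add: hopf_algebra_def sweedler_def)

lemma counit_left_linear:
  assumes "Vector_Spaces.linear sH r f"
  shows "sw h (\<lambda>a b. f (sH (\<epsilon> a) b)) = f h" "sw h (\<lambda>a b. r (\<epsilon> a) (f b)) = f h"
  using sweedler_linear[OF assms, of h "\<lambda>a b. sH (\<epsilon> a) b"]
  by (simp_all add: counit_left linear_scale[OF assms])

lemma counit_right_linear:
  assumes "Vector_Spaces.linear sH r f"
  shows "sw h (\<lambda>a b. f (sH (\<epsilon> b) a)) = f h" "sw h (\<lambda>a b. r (\<epsilon> b) (f a)) = f h"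
  using sweedler_linear[OF assms, of h "\<lambda>a b. sH (\<epsilon> b) a"]
  by (simp_all add: counit_right linear_scale[OF assms])

lemma sweedler_mult:
  assumes F: "\<And>y. Vector_Spaces.linear sH r (\<lambda>x. F x y)" "\<And>x. Vector_Spaces.linear sH r (\<lambda>y. F x y)"
  shows "sw (x * y) F = sw x (\<lambda>a b. sw y (\<lambda>c d. F (a * c) (b * d)))"
proof -
  let ?t = "\<Sum>(a, b)\<in>#comult C x. image_mset (\<lambda>(a', b'). (a * a', b * b')) (comult C y)"
  have "sw (x * y) F = (\<Sum>(a, b)\<in>#?t. F a b)"
    unfolding sweedler_def
    by (rule sweedler_sum_eq[OF _ F]) (use hopf in \<open>simp add: hopf_algebra_def\<close>)
  then show ?thesis
    unfolding sweedler_def case_prod_unfold sum_mset_sum_mset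
    by (simp add: image_mset.compositionality comp_def)
qed

lemma sweedler_one:
  assumes F: "\<And>y. Vector_Spaces.linear sH r (\<lambda>x. F x y)" "\<And>x. Vector_Spaces.linear sH r (\<lambda>y. F x y)"
  shows "sw 1 F = F 1 1"
proof -
  have "sw 1 F = (\<Sum>(a, b)\<in>#{#(1, 1)#}. F a b)"
    unfolding sweedler_def
    by (rule sweedler_sum_eq[OF _ F]) (use hopf in \<open>simp add: hopf_algebra_def\<close>)
  then show ?thesis by simp
qed

lemma antipode_scale: "S (sH c x) = sH c (S x)"
  by (rule linear_scale[OF antipode_linear])

lemma antipode_one: "S 1 = 1"
  using sweedler_one[of sH "\<lambda>a b. S a * b"] antipode_left[of 1]
  by (simp add: linear_rules)

lemma counit_antipode: "\<epsilon> (S x) = \<epsilon> x"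
proof -
  have "\<epsilon> (S x) = sw x (\<lambda>a b. \<epsilon> (S (sH (\<epsilon> b) a)))"
    by (rule counit_right_linear(1)[symmetric, where r = "(*)"]) (intro linear_rules)
  also have "\<dots> = \<epsilon> (sw x (\<lambda>a b. S a * b))"
    by (simp add: sweedler_linear[OF counit_linear] antipode_scale mult.commute)
  also have "\<dots> = \<epsilon> x"
    by (simp add: antipode_left)
  finally show ?thesis .
qed

text \<open>Both sides are convolution inverses of the product map \<open>H \<otimes> H \<rightarrow> H\<close>.\<close>

lemma antipode_mult: "S (x * y) = S y * S x"
proof -
  \<comment> \<open>K is S(x_1 y_1) x_2 y_2 S(y_3) S(x_3). Cancelling the first factor against x_2
    y_2 leaves S(y) S(x); after regrouping by coassociativity, cancelling y_2 S(y_3) and then x_2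
    S(x_3) leaves S(x y).\<close>
  define K where "K = sw x (\<lambda>x1 x2. sw y (\<lambda>y1 y2.
    sw x1 (\<lambda>a b. sw y1 (\<lambda>c d. S (a * c) * (b * d) * (S y2 * S x2)))))"
  have "K = sw x (\<lambda>x1 x2. sw y (\<lambda>y1 y2. sw (x1 * y1) (\<lambda>p q. S p * q) * (S y2 * S x2)))"
    unfolding K_def
    by (simp add: sweedler_mult[where r = sH and F = "\<lambda>p q. S p * q"] linear_rules
        sweedler_mult_left)
  also have "\<dots> = sw x (\<lambda>x1 x2. sw y (\<lambda>y1 y2. sH (\<epsilon> y1) (S y2) * sH (\<epsilon> x1) (S x2)))"
    by (simp add: antipode_left scale_mult)
  also have "\<dots> = S y * S x"
    by (simp add: sweedler_mult_left sweedler_mult_right counit_left_linear[OF antipode_linear])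
  finally have 1: "K = S y * S x" .
  define G where "G = (\<lambda>a b x2. sw y (\<lambda>y1 y2.
    sw y1 (\<lambda>c d. S (a * c) * (b * d) * (S y2 * S x2))))"
  have "K = sw x (\<lambda>x1 x2. sw x1 (\<lambda>a b. G a b x2))"
    unfolding K_def G_def sweedler_swap[of y] ..
  also have "\<dots> = sw x (\<lambda>a x'. sw x' (\<lambda>b x2. G a b x2))"
    unfolding G_def by (intro coassoc[where r = sH] linear_rules)
  also have "G = (\<lambda>a b x2. sw y (\<lambda>c y'. sw y' (\<lambda>d y2. S (a * c) * (b * d) * (S y2 * S x2))))"
    unfolding G_def by (intro ext coassoc[where r = sH] linear_rules)
  also have "sw x (\<lambda>a x'. sw x' (\<lambda>b x2. sw y (\<lambda>c y'.
      sw y' (\<lambda>d y2. S (a * c) * (b * d) * (S y2 * S x2))))) = sw x (\<lambda>a x'. sw x' (\<lambda>b x2. sw y (\<lambda>c y'.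
    S (a * c) * (b * sw y' (\<lambda>d y2. d * S y2)  * S x2))))"
    by (simp add: sweedler_mult_left sweedler_mult_right flip: mult.assoc)
      (simp add: sweedler_mult_left sweedler_mult_right mult.assoc)
  also have "\<dots> = sw x (\<lambda>a x'. sw y (\<lambda>c y'. S (a * sH (\<epsilon> y') c) * sw x' (\<lambda>b x2. b * S x2)))"
    by (subst sweedler_swap) 
     (simp add: antipode_right scale_mult antipode_scale sweedler_mult_right sweedler_scaleH mult.commute)
  also have "\<dots> = sw x (\<lambda>a x'. sH (\<epsilon> x') (sw y (\<lambda>c y'. sH (\<epsilon> y') (S (a * c)))))"
    by (simp add: antipode_right scale_mult antipode_scale flip: sweedler_scaleH)
  also have "(\<lambda>a. sw y (\<lambda>c y'. sH (\<epsilon> y') (S (a * c)))) = (\<lambda>a. S (a * y))"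
    by (intro ext counit_right_linear(2) linear_rules)
  also have "sw x (\<lambda>a x'. sH (\<epsilon> x') (S (a * y))) = S (x * y)"
    by (intro counit_right_linear(2)[where f = "\<lambda>a. S (a * y)"] linear_rules)
  finally show ?thesis using 1 by simp
qed

end

section \<open>The inverse of the antipode\<close>

locale hopf_bij = hopf +
  assumes bij_antipode: "bij S"
begin

abbreviation T where "T \<equiv> inv S"

lemma ST [simp]: "S (T x) = x" and TS [simp]: "T (S x) = x"
  using bij_antipode by (auto simp: bij_is_surj bij_is_inj surj_f_inv_f)

lemma T_eq_iff: "T x = y \<longleftrightarrow> x = S y"
  by auto

lemma T_linear: "Vector_Spaces.linear sH sH T"
  using linear_add[OF antipode_linear]
  by (simp add: Vector_Spaces.linear_iff H.vector_space_axioms T_eq_iff antipode_scale)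

lemma linear_T [linear_rules]:
  "Vector_Spaces.linear q sH f \<Longrightarrow> Vector_Spaces.linear q sH (\<lambda>x. T (f x))"
  by (rule linear_comp[OF T_linear])

lemma T_scale: "T (sH c x) = sH c (T x)"
  by (rule linear_scale[OF T_linear])

lemma T_mult: "T (x * y) = T y * T x"
  by (simp add: T_eq_iff antipode_mult)

lemma T_one: "T 1 = 1"
  by (simp add: T_eq_iff antipode_one)

text \<open>S^-1 reverses products, so it turns the axiom for S(x_1) x_2 into this one, with the
  coproduct legs in the opposite order.\<close>

lemma T_left: "sw x (\<lambda>a b. T b * a) = sH (\<epsilon> x) 1"
proof -
  have "sw x (\<lambda>a b. T b * a) = sw x (\<lambda>a b. T (S a * b))"
    by (simp add: T_mult)
  also have "\<dots> = sH (\<epsilon> x) 1"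
    by (simp add: sweedler_linear[OF T_linear, symmetric] antipode_left T_scale T_one)
  finally show ?thesis .
qed

lemma T_right: "sw x (\<lambda>a b. b * T a) = sH (\<epsilon> x) 1"
proof -
  have "sw x (\<lambda>a b. b * T a) = sw x (\<lambda>a b. T (a * S b))"
    by (simp add: T_mult)
  also have "\<dots> = sH (\<epsilon> x) 1"
    by (simp add: sweedler_linear[OF T_linear, symmetric] antipode_right T_scale T_one)
  finally show ?thesis .
qed

end

section \<open>The calculus\<close>

locale bicov = hopf_bij C
  for C :: "('k::field, 'h::ring_1, 'v::ab_group_add, 'w::ab_group_add, 'x::ab_group_add, 'z) calculus_scheme" +
  assumes calc: "bicovariant_calculus C"
begin

abbreviation sV where "sV \<equiv> vscale C"
abbreviation sW where "sW \<equiv> scale1 C"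
abbreviation la where "la \<equiv> lact1 C"
abbreviation ra where "ra \<equiv> ract1 C"
abbreviation d where "d \<equiv> extd0 C"
abbreviation P where "P \<equiv> tproj0 C"
abbreviation e where "e \<equiv> maurer_cartan C"

sublocale V: vector_space sV
  using calc by (simp add: bicovariant_calculus_def)

lemma bimod: "bimodule sH la ra"
  using calc by (simp add: bicovariant_calculus_def)

lemma la_add: "la a (m + n) = la a m + la a n" "la (a + b) m = la a m + la b m"
  and ra_add: "ra (m + n) a = ra m a + ra n a" "ra m (a + b) = ra m a + ra m b"
  and la_mult: "la (a * b) m = la a (la b m)"
  and ra_mult: "ra m (a * b) = ra (ra m a) b"
  and act_one [simp]: "la 1 m = m" "ra m 1 = m"
  and la_ra: "ra (la a m) b = la a (ra m b)"
  and la_ra_scalar: "la (sH c 1) m = ra m (sH c 1)"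
  using bimod unfolding bimodule_def by simp_all

lemma la_neg: "la (- a) m = - la a m"
  using la_add(2)[of a "- a" m] la_add(2)[of 0 0 m] by (simp add: minus_unique)

lemma vector_space_sW: "vector_space sW"
  by unfold_locales (simp_all add: scale1_def la_add H.scale_left_distrib
    scale_mult mult.commute flip: la_mult)

sublocale W: vector_space sW by (rule vector_space_sW)

lemma sW_ra: "sW c m = ra m (sH c 1)"
  by (simp add: scale1_def la_ra_scalar)

lemma linear_la [linear_rules]:
  "Vector_Spaces.linear q sH f \<Longrightarrow> Vector_Spaces.linear q sW (\<lambda>x. la (f x) w)"
  "Vector_Spaces.linear q sW g \<Longrightarrow> Vector_Spaces.linear q sW (\<lambda>x. la h (g x))"
  by (simp_all add: Vector_Spaces.linear_iff la_add W.vector_space_axioms)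
    (simp_all add: scale1_def scale_mult flip: la_mult)

lemma linear_ra [linear_rules]:
  "Vector_Spaces.linear q sH f \<Longrightarrow> Vector_Spaces.linear q sW (\<lambda>x. ra w (f x))"
  "Vector_Spaces.linear q sW g \<Longrightarrow> Vector_Spaces.linear q sW (\<lambda>x. ra (g x) h)"
  by (simp_all add: Vector_Spaces.linear_iff ra_add W.vector_space_axioms)
    (simp_all add: sW_ra scale_mult flip: ra_mult)

section \<open>The quotient Omega_0 with its action and coaction\<close>

lemma Q_counit: "x \<in> QH C \<Longrightarrow> \<epsilon> x = 0"
  and Q_mult: "x \<in> QH C \<Longrightarrow> x * h \<in> QH C"
  using calc by (auto simp: bicovariant_calculus_def ker_counit_def)

lemma Q_Ad: "x \<in> QH C \<Longrightarrow> \<exists>z. set_mset z \<subseteq> QH C \<times> UNIV \<and> ktensor_eq sH sH (Ad C x) z"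
  using calc by (simp add: bicovariant_calculus_def)

lemma proj0_add: "\<epsilon> x = 0 \<Longrightarrow> \<epsilon> y = 0 \<Longrightarrow> proj0 C (x + y) = proj0 C x + proj0 C y"
  and proj0_scale: "\<epsilon> x = 0 \<Longrightarrow> proj0 C (sH c x) = sV c (proj0 C x)"
  and proj0_eq_0: "\<epsilon> x = 0 \<Longrightarrow> proj0 C x = 0 \<longleftrightarrow> x \<in> QH C"
  and proj0_surj: "\<exists>x. \<epsilon> x = 0 \<and> proj0 C x = v"
proof -
  assume "\<epsilon> x = 0" 
  then show "proj0 C (sH c x) = sV c (proj0 C x)" "proj0 C x = 0 \<longleftrightarrow> x \<in> QH C"
    using calc unfolding bicovariant_calculus_def ker_counit_def by blast+
next
  assume "\<epsilon> x = 0" "\<epsilon> y = 0"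
  then show "proj0 C (x + y) = proj0 C x + proj0 C y"
    using calc unfolding bicovariant_calculus_def ker_counit_def by blast
next
  have "v \<in> proj0 C ` ker_counit C"
    using calc unfolding bicovariant_calculus_def by blast
  then show "\<exists>x. \<epsilon> x = 0 \<and> proj0 C x = v"
    by (auto simp: ker_counit_def)
qed

text \<open>The counit part is subtracted first, so linearity holds on all of H although
  \<open>proj0\<close> is controlled on ker \<epsilon> only. Sweedler legs can then be projected one
  at a time.\<close>

lemma P_linear: "Vector_Spaces.linear sH sV P"
proof -
  have "P (x + y) = P x + P y" for x y
    using proj0_add[of "x - sH (\<epsilon> x) 1" "y - sH (\<epsilon> y) 1"]
    by (simp add: tproj0_def H.scale_left_distrib algebra_simps)
  moreover have "P (sH c x) = sV c (P x)" for c x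
    using proj0_scale[of "x - sH (\<epsilon> x) 1" c]
    by (simp add: tproj0_def H.scale_right_diff_distrib)
  ultimately show ?thesis
    by (simp add: Vector_Spaces.linear_iff H.vector_space_axioms V.vector_space_axioms)
qed

lemma linear_P [linear_rules]:
  "Vector_Spaces.linear q sH f \<Longrightarrow> Vector_Spaces.linear q sV (\<lambda>x. P (f x))"
  by (rule linear_comp[OF P_linear])

lemma P_proj0: "\<epsilon> x = 0 \<Longrightarrow> P x = proj0 C x"
  by (simp add: tproj0_def)

lemma P_one: "P 1 = 0"
  using P_linear[THEN linear_zero] by (simp add: tproj0_def)

lemma P_Q: "x \<in> QH C \<Longrightarrow> P x = 0"
  using P_proj0 Q_counit proj0_eq_0 by metis

text \<open>The kernel of the extended projection is Q_H + k 1; this is why maps passed to Omega_0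
  have to kill both Q_H and 1.\<close>

lemma P_eqD: "P x = P y \<Longrightarrow> \<exists>q\<in>QH C. \<exists>c. x = y + q + sH c 1"
proof
  assume "P x = P y"
  let ?q = "x - y - sH (\<epsilon> (x - y)) 1"
  have "proj0 C ?q = 0"
    using \<open>P x = P y\<close> linear_diff[OF P_linear, of x y] by (simp add: tproj0_def)
  then show "?q \<in> QH C"
    using proj0_eq_0[of ?q] by simp
  show "\<exists>c. x = y + ?q + sH c 1"
    by (rule exI[of _ "\<epsilon> (x - y)"]) simp
qed

lemma lift0: "\<epsilon> (lift0 C v) = 0" "proj0 C (lift0 C v) = v"
  using someI_ex[of "\<lambda>h. h \<in> ker_counit C \<and> proj0 C h = v"] proj0_surj[of v]
  unfolding lift0_def ker_counit_def by auto

lemma P_lift0 [simp]: "P (lift0 C v) = v"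
  by (simp add: P_proj0 lift0)

text \<open>Operations on Omega_0 are defined through a chosen lift. A linear map killing 1 and Q_H
  depends only on the class, so it may be computed on any representative g, even one outside ker
  \<epsilon>.\<close>

lemma linear_descends:
  assumes f: "Vector_Spaces.linear sH r f" and "f 1 = 0" "\<And>q. q \<in> QH C \<Longrightarrow> f q = 0"
  shows "f (lift0 C (P g)) = f g" "Vector_Spaces.linear sV r (\<lambda>v. f (lift0 C v))"
proof -
  have *: "f x = f y" if xy: "P x = P y" for x y
  proof -
    obtain q c where "q \<in> QH C" "x = y + q + sH c 1" using P_eqD[OF xy] by blast
    moreover have "r c 0 = 0"
      by (metis H.scale_zero_right f linear_scale linear_zero)
    ultimately show ?thesis
      by (simp add: linear_add[OF f] linear_scale[OF f] assms(2,3))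
  qed
  show "f (lift0 C (P g)) = f g" by (rule *) simp
  have "f (lift0 C (x + y)) = f (lift0 C x) + f (lift0 C y)" for x y
    unfolding linear_add[OF f, symmetric] by (rule *) (simp add: linear_add[OF P_linear])
  moreover have "f (lift0 C (sV c x)) = r c (f (lift0 C x))" for c x
    unfolding linear_scale[OF f, symmetric] by (rule *) (simp add: linear_scale[OF P_linear])
  ultimately show "Vector_Spaces.linear sV r (\<lambda>v. f (lift0 C v))"
    using f by (simp add: Vector_Spaces.linear_iff V.vector_space_axioms)
qed

text \<open>Modulo the right ideal Q_H the lift of \<open>P g\<close> is g - \<epsilon>(g) 1;
  multiplying it by h produces the counit correction.\<close>

lemma act0_P: "act0 C (P g) h = P (g * h) - sV (\<epsilon> g) (P h)"
  and linear_act0_left: "Vector_Spaces.linear sV sV (\<lambda>v. act0 C v h)"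
proof -
  let ?f = "\<lambda>g. P (g * h) - sV (\<epsilon> g) (P h)"
  have f: "Vector_Spaces.linear sH sV ?f"
    by (simp add: Vector_Spaces.linear_iff H.vector_space_axioms V.vector_space_axioms
        linear_add[OF P_linear] linear_scale[OF P_linear] scale_mult V.scale_left_distrib
        V.scale_right_diff_distrib algebra_simps)
  have act: "act0 C v h = ?f (lift0 C v)" for v
    by (simp add: act0_def lift0 P_proj0)
  show "act0 C (P g) h = P (g * h) - sV (\<epsilon> g) (P h)"
    "Vector_Spaces.linear sV sV (\<lambda>v. act0 C v h)"
    unfolding act using linear_descends[OF f] Q_counit Q_mult P_Q by simp_all
qed

lemma linear_act0 [linear_rules]:
  "Vector_Spaces.linear q sV f \<Longrightarrow> Vector_Spaces.linear q sV (\<lambda>x. act0 C (f x) h)"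
  "Vector_Spaces.linear q sH g \<Longrightarrow> Vector_Spaces.linear q sV (\<lambda>x. act0 C v (g x))"
proof -
  show "Vector_Spaces.linear q sV f \<Longrightarrow> Vector_Spaces.linear q sV (\<lambda>x. act0 C (f x) h)"
    by (rule linear_comp[OF linear_act0_left])
  have "act0 C v h = P (lift0 C v * h)" for h
    by (simp add: act0_def P_proj0 lift0)
  then show "Vector_Spaces.linear q sH g \<Longrightarrow> Vector_Spaces.linear q sV (\<lambda>x. act0 C v (g x))"
    by (simp add: linear_P linear_mult)
qed

lemma linear_idV [linear_rules]: "Vector_Spaces.linear sV sV (\<lambda>x. x)"
  by (simp add: Vector_Spaces.linear_iff V.vector_space_axioms)

definition coact_sum :: "'v \<Rightarrow> ('v \<Rightarrow> 'h \<Rightarrow> 'm::comm_monoid_add) \<Rightarrow> 'm" where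
  "coact_sum v F = (\<Sum>(a, b)\<in>#coact0 C v. F a b)"

lemma coact_sum_lift0: "coact_sum v F = sw (lift0 C v) (\<lambda>a y. sw y (\<lambda>b c. F (P b) (S a * c)))"
  using sum_Ad[of "\<lambda>a b. F (P a) b" "lift0 C v"]
  by (simp add: coact_sum_def coact0_def image_mset.compositionality comp_def case_prod_unfold)

text \<open>The sum descends to Omega_0: it vanishes on 1 because \<open>P 1 = 0\<close>, and on Q_H
  because Ad-stability supplies a representative of Ad(q) whose first legs are killed by
  \<open>P\<close>.\<close>

lemma
  assumes F: "\<And>y. Vector_Spaces.linear sV r (\<lambda>x. F x y)" "\<And>x. Vector_Spaces.linear sH r (\<lambda>y. F x y)"
  shows coact_sum_P: "coact_sum (P g) F = sw g (\<lambda>a y. sw y (\<lambda>b c. F (P b) (S a * c)))"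
    and coact_sum_linear: "Vector_Spaces.linear sV r (\<lambda>v. coact_sum v F)"
proof -
  let ?f = "\<lambda>g. sw g (\<lambda>a y. sw y (\<lambda>b c. F (P b) (S a * c)))"
  have FP [linear_rules]: "Vector_Spaces.linear q r (\<lambda>x. F (P (f x)) y)"
    if "Vector_Spaces.linear q sH f" for q y and f :: "'y::ab_group_add \<Rightarrow> 'h"
    using linear_comp[OF F(1) linear_P[OF that]] .
  have FS [linear_rules]: "Vector_Spaces.linear q r (\<lambda>x. F y (f x))"
    if "Vector_Spaces.linear q sH f" for q y and f :: "'y::ab_group_add \<Rightarrow> 'h"
    using linear_comp[OF F(2) that] .
  have lin: "Vector_Spaces.linear sH r ?f"
    by (intro linear_rules FP FS)
  have one: "?f 1 = 0"
    by (subst sweedler_one[where r = r], (intro linear_rules FP FS)+,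
        subst sweedler_one[where r = r], (intro linear_rules FP FS)+)
      (simp add: P_one linear_zero[OF F(1)])
  have Q: "?f q = 0" if q: "q \<in> QH C" for q
  proof -
    obtain z where z: "set_mset z \<subseteq> QH C \<times> UNIV" "ktensor_eq sH sH (Ad C q) z"
      using Q_Ad[OF q] by blast
    have "?f q = (\<Sum>(a, b)\<in>#Ad C q. F (P a) b)"
      by (simp add: sum_Ad)
    also have "\<dots> = (\<Sum>(a, b)\<in>#z. F (P a) b)"
      by (rule sweedler_sum_eq[OF z(2), where r = r]) (intro linear_rules FP FS)+
    also have "\<dots> = (\<Sum>p\<in>#z. 0)"
      using z(1) by (intro arg_cong[where f = sum_mset] image_mset_cong)
        (auto simp: P_Q linear_zero[OF F(1)])
    finally show ?thesis by simp
  qed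
  show "coact_sum (P g) F = ?f g" "Vector_Spaces.linear sV r (\<lambda>v. coact_sum v F)"
    using linear_descends[OF lin one Q] by (simp_all add: coact_sum_lift0)
qed

section \<open>One-forms and the differential of functions\<close>

lemma proj1_cong: "t \<in> OmegaU1 \<Longrightarrow> ktensor_eq sH sH t u \<Longrightarrow> proj1 C t = proj1 C u"
  and proj1_add: "t \<in> OmegaU1 \<Longrightarrow> u \<in> OmegaU1 \<Longrightarrow> proj1 C (t + u) = proj1 C t + proj1 C u"
  and proj1_la: "t \<in> OmegaU1 \<Longrightarrow> proj1 C (image_mset (\<lambda>(a, b). (h * a, b)) t) = la h (proj1 C t)"
  and proj1_ra: "t \<in> OmegaU1 \<Longrightarrow> proj1 C (image_mset (\<lambda>(a, b). (a, b * h)) t) = ra (proj1 C t) h"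
  and proj1_eq_0: "t \<in> OmegaU1 \<Longrightarrow> proj1 C t = 0 \<longleftrightarrow> t \<in> NH C"
  using calc unfolding bicovariant_calculus_def by blast+

lemma proj1_surj: "\<exists>t\<in>OmegaU1. proj1 C t = w"
proof -
  have "w \<in> proj1 C ` OmegaU1" using calc unfolding bicovariant_calculus_def by blast
  then show ?thesis by blast
qed

lemma OmegaU1_add: "t \<in> OmegaU1 \<Longrightarrow> u \<in> OmegaU1 \<Longrightarrow> t + u \<in> OmegaU1"
  by (simp add: OmegaU1_def)

lemma proj1_empty: "proj1 C {#} = 0"
  using proj1_add[of "{#}" "{#}"] by (simp add: OmegaU1_def)

lemma HH_eq_cancel:
  "ktensor_eq sH sH {#(a, b), (- a, b)#} {#}"
  by (rule tensor_eq_negative_left) simp_all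

lemma d_mem: "{#(1, x), (- x, 1)#} \<in> (OmegaU1 :: ('h \<times> 'h) multiset set)"
  by (simp add: OmegaU1_def)

lemma la_d: "la a (d b) = proj1 C {#(a, b), (- (a * b), 1)#}"
  using proj1_la[OF d_mem, of a b] by (simp add: extd0_def)

lemma ra_d: "ra (d b) a = proj1 C {#(1, b * a), (- b, a)#}"
  using proj1_ra[OF d_mem, of a b] by (simp add: extd0_def)

lemma d_linear: "Vector_Spaces.linear sH sW d"
proof -
  have "d (x + y) = d x + d y" for x y
  proof -
    have "ktensor_eq sH sH ({#(1, x + y)#} + {#(- x + - y, 1)#})
        ({#(1, x), (1, y)#} + {#(- x, 1), (- y, 1)#})"
      by (intro additive_congruence_add tensor_eq_add_right tensor_eq_add_left) simp_all
    then have "ktensor_eq sH sH {#(1, x + y), (- (x + y), 1)#}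
        ({#(1, x), (- x, 1)#} + {#(1, y), (- y, 1)#})"
      by (simp add: add_mset_commute)
    from proj1_cong[OF d_mem this] show ?thesis
      by (simp only: proj1_add[OF d_mem d_mem] extd0_def)
  qed
  moreover have "d (sH c x) = sW c (d x)" for c x
  proof -
    have "ktensor_eq sH sH {#(sH c 1, x)#} {#(1, sH c x)#}"
      by (intro additive_congruence.base tensor_relation.balanced) simp_all
    from additive_congruence.add[OF additive_congruence.sym[OF this], of "{#(- sH c x, 1)#}"]
    have "ktensor_eq sH sH {#(1, sH c x), (- sH c x, 1)#} {#(sH c 1, x), (- (sH c 1 * x), 1)#}"
      by (simp add: scale_mult add_mset_commute)
    from proj1_cong[OF d_mem this] have "d (sH c x) = proj1 C {#(sH c 1, x), (- (sH c 1 * x), 1)#}"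
      by (simp add: extd0_def)
    then show ?thesis
      by (simp only: scale1_def la_d)
  qed
  ultimately show ?thesis
    by (simp add: Vector_Spaces.linear_iff H.vector_space_axioms W.vector_space_axioms)
qed

lemma linear_d [linear_rules]:
  "Vector_Spaces.linear q sH f \<Longrightarrow> Vector_Spaces.linear q sW (\<lambda>x. d (f x))"
  by (rule linear_comp[OF d_linear])

lemma leibniz: "d (x * y) = la x (d y) + ra (d x) y"
proof -
  let ?t = "{#(x, y), (- (x * y), 1)#}" and ?u = "{#(1, x * y), (- x, y)#}"
  have mem: "?t \<in> OmegaU1" "?u \<in> OmegaU1" by (simp_all add: OmegaU1_def)
  have "ktensor_eq sH sH ({#(x, y), (- x, y)#} + {#(1, x * y), (- (x * y), 1)#})
      ({#} + {#(1, x * y), (- (x * y), 1)#})"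
    by (intro additive_congruence.add HH_eq_cancel)
  then have "ktensor_eq sH sH (?t + ?u) {#(1, x * y), (- (x * y), 1)#}"
    by (simp add: add_mset_commute)
  from proj1_cong[OF OmegaU1_add[OF mem] this] have "d (x * y) = proj1 C ?t + proj1 C ?u"
    unfolding proj1_add[OF mem] extd0_def by simp
  then show ?thesis
    by (simp only: la_d ra_d)
qed

lemma d_one: "d 1 = 0"
  using proj1_cong[OF d_mem HH_eq_cancel] by (simp add: extd0_def proj1_empty)

text \<open>The products ab sum to zero, so adding all terms -(ab) \<otimes> 1 leaves the tensor
  unchanged; each a \<otimes> b - ab \<otimes> 1 is then a db.\<close>

lemma proj1_eq_sum:
  assumes "t \<in> OmegaU1"
  shows "proj1 C t = (\<Sum>(a, b)\<in>#t. la a (d b))"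
proof -
  let ?u = "image_mset (\<lambda>(a, b). (- (a * b), 1)) t"
  have "ktensor_eq sH sH {#(\<Sum>(a, b)\<in>#t. - (a * b), 1)#} ?u"
    using tensor_eq_sum_left[of UNIV t "\<lambda>(a, b). - (a * b)" "\<lambda>a c. sH c a" sH 1]
    by (simp add: case_prod_unfold)
  moreover have "(\<Sum>(a, b)\<in>#t. - (a * b)) = - (\<Sum>(a, b)\<in>#t. a * b)"
    by (induction t) (simp_all add: case_prod_unfold)
  ultimately have "ktensor_eq sH sH ?u {#}"
    using assms tensor_eq_zero_left[of UNIV "\<lambda>a c. sH c a" sH 1]
    by (simp add: OmegaU1_def) (blast intro: additive_congruence.sym additive_congruence.trans)
  from additive_congruence_add[OF additive_congruence.refl[of _ t] additive_congruence.sym[OF this]]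
  have "proj1 C t = proj1 C (t + ?u)"
    by (intro proj1_cong assms) simp
  also have "\<dots> = proj1 C (\<Sum>(a, b)\<in>#t. {#(a, b), (- (a * b), 1)#})"
  proof -
    have "t + ?u = (\<Sum>(a, b)\<in>#t. {#(a, b), (- (a * b), 1)#})" by (induction t) auto
    then show ?thesis by simp
  qed
  \<comment> \<open>Additivity of \<open>proj1\<close> is available on universal one-forms only, so
    membership is carried through the induction.\<close>
  also have "\<dots> = (\<Sum>(a, b)\<in>#t. la a (d b)) \<and> (\<Sum>(a, b)\<in>#t. {#(a, b), (- (a * b), 1)#}) \<in> OmegaU1" (is "?A t \<and> ?B t")
  proof (induction t)
    case empty
    show ?case by (simp add: proj1_empty OmegaU1_def)
  next
    case (add p t)
    obtain a b where p: "p = (a, b)" by force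
    have m: "{#(a, b), (- (a * b), 1)#} \<in> OmegaU1" by (simp add: OmegaU1_def)
    show ?case
      using add proj1_add[OF m] OmegaU1_add[OF m] by (simp add: p la_d)
  qed
  finally show ?thesis by blast
qed

section \<open>The Maurer-Cartan form\<close>

lemma la_zero: "la 0 w = 0" "la h 0 = 0"
  using linear_zero[OF linear_la(1)[OF linear_id]]
    la_add(1)[of h 0 0] by simp_all

text \<open>Outside ker \<epsilon> the sum S(g_1) \<otimes> g_2 is not a universal one-form, but
  S(g_1) dg_2 still makes sense, and it kills 1 because d1 = 0.\<close>

definition maurer_cartan_lift where "maurer_cartan_lift g = sw g (\<lambda>a b. la (S a) (d b))"

lemma maurer_cartan_lift_linear: "Vector_Spaces.linear sH sW maurer_cartan_lift"
  unfolding maurer_cartan_lift_def by (intro linear_rules)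

lemma maurer_cartan_representative:
  assumes "\<epsilon> g = 0"
  shows "image_mset (\<lambda>(a, b). (S a, b)) (comult C g) \<in> OmegaU1"
    and "proj1 C (image_mset (\<lambda>(a, b). (S a, b)) (comult C g)) = maurer_cartan_lift g"
proof -
  show mem: "image_mset (\<lambda>(a, b). (S a, b)) (comult C g) \<in> OmegaU1"
    using antipode_left[of g] assms
    by (simp add: OmegaU1_def sweedler_def image_mset.compositionality comp_def case_prod_unfold)
  show "proj1 C (image_mset (\<lambda>(a, b). (S a, b)) (comult C g)) = maurer_cartan_lift g"
    unfolding proj1_eq_sum[OF mem]
    by (simp add: maurer_cartan_lift_def sweedler_def image_mset.compositionality comp_def case_prod_unfold)
qed

lemma e_eq_maurer_cartan_lift: "e v = maurer_cartan_lift (lift0 C v)"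
  by (simp add: maurer_cartan_def maurer_cartan_representative lift0)

lemma maurer_cartan_lift_one: "maurer_cartan_lift 1 = 0"
  unfolding maurer_cartan_lift_def
  by (subst sweedler_one[where r = sW]) (intro linear_rules | simp add: d_one la_zero)+

text \<open>The isomorphism defining \<open>N\<^sub>H\<close> sends \<open>S(q\<^sub>1) \<otimes> q\<^sub>2\<close> to \<open>1 \<otimes> q\<close>.\<close>

lemma maurer_cartan_lift_Q:
  assumes q: "q \<in> QH C"
  shows "maurer_cartan_lift q = 0"
proof -
  let ?E = "ktensor_eq sH sH"
  let ?t = "image_mset (\<lambda>(a, b). (S a, b)) (comult C q)"
  let ?u = "\<Sum>(a, b)\<in>#comult C q. image_mset (\<lambda>(a1, a2). (a1, a2, b)) (comult C a)"
  let ?F = "\<lambda>(a, b, c). {#(S a * b, c)#}"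
  have S_add: "S (a + b) = S a + S b" for a b by (rule linear_add[OF antipode_linear])
  have "S 0 = 0" by (rule linear_zero[OF antipode_linear])
  note S_lin = S_add this antipode_scale
  \<comment> \<open>The target is again a tensor product, so coassociativity is pushed forward along
    a \<otimes> b \<otimes> c |-> S(a) b \<otimes> c by checking the defining relations.\<close>
  have base: "?E (\<Sum>p\<in>#t. ?F p) (\<Sum>p\<in>#u. ?F p)" if "tensor3_relation sH sH sH t u" for t u
    using that
  proof cases
    case (scale12 r a b c)
    then show ?thesis by (simp add: S_lin scale_mult additive_congruence.refl)
  next
    case (scale23 a r b c)
    have "?E {#(sH r (S a * b), c)#} {#(S a * b, sH r c)#}"
      by (intro additive_congruence.base tensor_relation.balanced) simp_all
    then show ?thesis using scale23 by (simp add: scale_mult)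
  next
    case (add1 a a' b c)
    then show ?thesis
      using tensor_eq_add_left[of "S a * b" UNIV "S a' * b" "\<lambda>a c. sH c a" sH c]
      by (simp add: S_lin distrib_right add_mset_commute)
  next
    case (add2 a b b' c)
    then show ?thesis
      using tensor_eq_add_left[of "S a * b" UNIV "S a * b'" "\<lambda>a c. sH c a" sH c]
      by (simp add: distrib_left add_mset_commute)
  next
    case (add3 a b c c')
    then show ?thesis
      using tensor_eq_add_right[of "S a * b" UNIV "\<lambda>a c. sH c a" sH c c'] by (simp add: add_mset_commute)
  next
    case (zero b c)
    then show ?thesis
      using tensor_eq_zero_left[of UNIV "\<lambda>a c. sH c a" sH c] by (simp add: S_lin)
  qed
  have "additive_congruence (tensor3_relation sH sH sH) ?u (comult2 C q)"
    using hopf by (simp add: hopf_algebra_def)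
  then have 1: "?E (\<Sum>p\<in>#?u. ?F p) (\<Sum>p\<in>#comult2 C q. ?F p)"
    using base by (rule additive_congruence_lift)
  have 2: "(\<Sum>p\<in>#comult2 C q. ?F p) =
      (\<Sum>(h, g)\<in>#?t. image_mset (\<lambda>(g1, g2). (h * g1, g2)) (comult C g))"
    unfolding comult2_def case_prod_unfold sum_mset_sum_mset
    by (simp add: image_mset.compositionality comp_def case_prod_unfold)
  let ?l = "\<Sum>(a, b)\<in>#comult C q. {#(1, sH (\<epsilon> a) b)#}"
  let ?r = "\<Sum>(a, b)\<in>#comult C q. image_mset (\<lambda>(a1, a2). (S a1 * a2, b)) (comult C a)"
  have lr: "?E ?l ?r"
  proof (intro additive_congruence_sum)
    fix p :: "'h \<times> 'h"
    obtain a b where p: "p = (a, b)" by force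
    have e1: "?E {#(sH (\<epsilon> a) 1, b)#} (image_mset (\<lambda>(a1, a2). (S a1 * a2, b)) (comult C a))"
      using tensor_eq_sum_left[of UNIV "comult C a" "\<lambda>(a1, a2). S a1 * a2" "\<lambda>a c. sH c a" sH b]
        antipode_left[of a]
      by (simp add: sweedler_def case_prod_unfold)
    have e2: "?E {#(sH (\<epsilon> a) 1, b)#} {#(1, sH (\<epsilon> a) b)#}"
      by (intro additive_congruence.base tensor_relation.balanced) simp_all
    show "?E (case p of (a, b) \<Rightarrow> {#(1, sH (\<epsilon> a) b)#})
        (case p of (a, b) \<Rightarrow> image_mset (\<lambda>(a1, a2). (S a1 * a2, b)) (comult C a))"
      using additive_congruence.trans[OF additive_congruence.sym[OF e2] e1] by (simp add: p)
  qed
  have r: "?r = (\<Sum>p\<in>#?u. ?F p)"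
    unfolding sum_mset_sum_mset
    unfolding case_prod_unfold image_mset.compositionality comp_def fst_conv snd_conv
      sum_mset_singleton_mset by (rule HOL.refl)
  have "?E {#(1, \<Sum>p\<in>#comult C q. sH (\<epsilon> (fst p)) (snd p))#}
      (image_mset (\<lambda>p. (1, sH (\<epsilon> (fst p)) (snd p))) (comult C q))"
    by (rule tensor_eq_sum_right) simp_all
  then have l: "?E {#(1, q)#} ?l"
    using counit_left[of q] unfolding sweedler_def case_prod_unfold sum_mset_singleton_mset by argo
  have "set_mset {#(1 :: 'h, q)#} \<subseteq> UNIV \<times> QH C"
    using q by simp
  moreover have "?E (\<Sum>(h, g)\<in>#?t. image_mset (\<lambda>(g1, g2). (h * g1, g2)) (comult C g)) {#(1, q)#}"
    using additive_congruence.sym[OF additive_congruence.trans[OF additive_congruence.trans[OF l lr[unfolded r]] 1]]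
    unfolding 2 .
  ultimately have "?t \<in> NH C"
    unfolding NH_def by (intro CollectI conjI exI maurer_cartan_representative(1)[OF Q_counit[OF q]])
  then show ?thesis
    using maurer_cartan_representative(2)[OF Q_counit[OF q]] proj1_eq_0[OF maurer_cartan_representative(1)[OF Q_counit[OF q]]]
    by simp
qed

lemma e_P: "e (P g) = maurer_cartan_lift g"
  and e_linear: "Vector_Spaces.linear sV sW e"
proof -
  have "e = (\<lambda>v. maurer_cartan_lift (lift0 C v))" by (simp add: fun_eq_iff e_eq_maurer_cartan_lift)
  then show "e (P g) = maurer_cartan_lift g" "Vector_Spaces.linear sV sW e"
    using linear_descends[OF maurer_cartan_lift_linear maurer_cartan_lift_one maurer_cartan_lift_Q] by simp_all
qed

lemma linear_e [linear_rules]: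
  "Vector_Spaces.linear q sV f \<Longrightarrow> Vector_Spaces.linear q sW (\<lambda>x. e (f x))"
  by (rule linear_comp[OF e_linear])

lemma linear_idW [linear_rules]: "Vector_Spaces.linear sW sW (\<lambda>x. x)"
  by (simp add: Vector_Spaces.linear_iff W.vector_space_axioms)

section \<open>Omega^1(H) as a left and right module over H\<close>

lemma act0_mult: "act0 C (act0 C v x) y = act0 C v (x * y)"
  using act0_P[of "lift0 C v"] act0_P[of "lift0 C v * x" y] by (simp add: lift0 mult.assoc)

lemma act0_one: "act0 C v 1 = v"
  using act0_P[of "lift0 C v" 1] by (simp add: lift0)

lemma act0_scale: "act0 C v (sH c h) = sV c (act0 C v h)"
  by (rule linear_scale[OF linear_act0(2)[OF linear_id]])

text \<open>For a lift g of v both sides equal S(g_1) d(g_2 h): on the left by the Leibniz rule, on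
  the right because e(v . h_2) contributes S(h_2) S(g_1), whose first factor cancels against
  h_1.\<close>

lemma e_ra: "ra (e v) h = sw h (\<lambda>a b. la a (e (act0 C v b)))"
proof -
  let ?g = "lift0 C v"
  have ra_d: "ra (d b) h = d (b * h) - la b (d h)" for b
    by (simp add: leibniz)
  have lin1: "Vector_Spaces.linear sW sW (\<lambda>m. ra m h)" "Vector_Spaces.linear sW sW (la h)" for h
    by (intro linear_rules)+
  have "ra (e v) h = sw ?g (\<lambda>a b. la (S a) (ra (d b) h))"
    unfolding e_eq_maurer_cartan_lift maurer_cartan_lift_def by (simp add: sweedler_linear[OF lin1(1)] la_ra)
  \<comment> \<open>The added term is S(g_1) g_2 dh = \<epsilon>(g) dh = 0; it completes the Leibniz
    expansion.\<close>
  also have "\<dots> = sw ?g (\<lambda>a b. la (S a) (ra (d b) h) + la (S a) (la b (d h)))"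
  proof -
    have "sw ?g (\<lambda>a b. la (S a) (la b (d h))) = la (sw ?g (\<lambda>a b. S a * b)) (d h)"
      by (simp add: sweedler_linear[OF linear_la(1)[OF linear_id]] la_mult)
    then show ?thesis by (simp add: sweedler_add antipode_left lift0 la_zero)
  qed
  also have "\<dots> = sw ?g (\<lambda>a b. la (S a) (d (b * h)))"
    by (simp add: ra_d flip: la_add(1))
  finally have L: "ra (e v) h = sw ?g (\<lambda>a b. la (S a) (d (b * h)))" .
  have "sw h (\<lambda>x y. la x (e (act0 C v y))) = sw h (\<lambda>x y. la x (maurer_cartan_lift (?g * y)))"
    using act0_P[of ?g] by (simp add: lift0 flip: e_P)
  also have "\<dots> = sw h (\<lambda>x y. sw ?g (\<lambda>a b. sw y (\<lambda>c z. la (x * (S c * S a)) (d (b * z)))))"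
    unfolding maurer_cartan_lift_def
    by (subst sweedler_mult[where r = sW], (intro linear_rules)+)
      (simp add: sweedler_linear[OF lin1(2)] la_mult antipode_mult)
  also have "\<dots> = sw ?g (\<lambda>a b. sw h (\<lambda>x y. sw y (\<lambda>c z. la (x * (S c * S a)) (d (b * z)))))"
    by (rule sweedler_swap)
  also have "(\<lambda>a b. sw h (\<lambda>x y. sw y (\<lambda>c z. la (x * (S c * S a)) (d (b * z))))) =
      (\<lambda>a b. sw h (\<lambda>y z. sw y (\<lambda>x c. la (x * (S c * S a)) (d (b * z)))))"
    by (intro ext coassoc[symmetric, where r = sW] linear_rules)
  also have "\<dots> = (\<lambda>a b. sw h (\<lambda>y z. la (sw y (\<lambda>x c. x * S c)) (la (S a) (d (b * z)))))"
    by (simp add: sweedler_linear[OF linear_la(1)[OF linear_id]] la_mult)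
  also have "\<dots> = (\<lambda>a b. sw h (\<lambda>y z. sW (\<epsilon> y) (la (S a) (d (b * z)))))"
    by (simp add: antipode_right scale1_def la_mult)
  also have "\<dots> = (\<lambda>a b. la (S a) (d (b * h)))"
    by (intro ext counit_left_linear(2) linear_rules)
  finally show ?thesis using L by simp
qed

text \<open>Here h_1 S(h_2) dh_3 = dh. Since every one-form is a sum of terms a db, this makes e
  generate Omega^1(H) from the left.\<close>

lemma d_eq: "d h = sw h (\<lambda>a b. la a (e (P b)))"
proof -
  have lin1: "Vector_Spaces.linear sW sW (la h)" for h
    by (intro linear_rules)+
  have "sw h (\<lambda>a b. la a (e (P b))) = sw h (\<lambda>a y. sw y (\<lambda>b c. la (a * S b) (d c)))"
    by (simp add: e_P maurer_cartan_lift_def sweedler_linear[OF lin1] la_mult)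
  also have "\<dots> = sw h (\<lambda>y c. sw y (\<lambda>a b. la (a * S b) (d c)))"
    by (intro coassoc[symmetric, where r = sW] linear_rules)
  also have "\<dots> = sw h (\<lambda>y c. la (sw y (\<lambda>a b. a * S b)) (d c))"
    by (simp add: sweedler_linear[OF linear_la(1)[OF linear_id]])
  also have "\<dots> = sw h (\<lambda>y c. sW (\<epsilon> y) (d c))"
    by (simp add: antipode_right scale1_def)
  also have "\<dots> = d h"
    by (intro counit_left_linear(2) linear_rules)
  finally show ?thesis by simp
qed

lemma left_generated: "\<exists>t. w = (\<Sum>(h, v)\<in>#t. la h (e v))"
proof -
  obtain t where t: "t \<in> OmegaU1" "proj1 C t = w" using proj1_surj by blast
  let ?u = "\<Sum>(a, b)\<in>#t. image_mset (\<lambda>(b1, b2). (a * b1, P b2)) (comult C b)"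
  have lin1: "Vector_Spaces.linear sW sW (la h)" for h
    by (intro linear_rules)+
  have "w = (\<Sum>(a, b)\<in>#t. la a (d b))" using proj1_eq_sum[OF t(1)] t(2) by simp
  also have "\<dots> = (\<Sum>(a, b)\<in>#t. sw b (\<lambda>b1 b2. la (a * b1) (e (P b2))))"
    by (subst d_eq) (simp add: sweedler_linear[OF lin1] la_mult)
  also have "\<dots> = (\<Sum>(h, v)\<in>#?u. la h (e v))"
    unfolding sum_mset_sum_mset case_prod_unfold
    by (simp add: sweedler_def image_mset.compositionality comp_def case_prod_unfold)
  finally show ?thesis ..
qed

text \<open>Expanding the right action by \<open>e_ra\<close> produces v . (S^-1(h_3) h_2), which
  collapses by \<open>T_left\<close>. Hence e generates from the right as well.\<close>

lemma la_e: "la h (e v) = sw h (\<lambda>a b. ra (e (act0 C v (T b))) a)"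
proof -
  have lin1: "Vector_Spaces.linear sH sW (\<lambda>x. la a (e (act0 C v x)))" for a
    by (intro linear_rules)
  have "sw h (\<lambda>x c. ra (e (act0 C v (T c))) x) =
      sw h (\<lambda>x c. sw x (\<lambda>a b. la a (e (act0 C v (T c * b)))))"
    by (simp add: e_ra act0_mult)
  also have "\<dots> = sw h (\<lambda>a y. sw y (\<lambda>b c. la a (e (act0 C v (T c * b)))))"
    by (intro coassoc[where r = sW] linear_rules)
  also have "\<dots> = sw h (\<lambda>a y. la a (e (act0 C v (sw y (\<lambda>b c. T c * b)))))"
    by (simp add: sweedler_linear[OF lin1])
  also have "\<dots> = sw h (\<lambda>a y. sW (\<epsilon> y) (la a (e v)))"
    by (simp add: T_left act0_scale act0_one linear_scale[OF e_linear]
        linear_scale[OF linear_la(2)[OF linear_idW]])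
  also have "\<dots> = la h (e v)"
    by (rule counit_right_linear(2)) (intro linear_rules)
  finally show ?thesis by simp
qed

text \<open>Left freeness as a universal property. The map h \<otimes> g |-> G(h g_1, pi g_2) is G
  composed with the isomorphism that defines N_H, so it vanishes on N_H and factors through
  \<open>proj1\<close>.\<close>

lemma extend_from_left_basis:
  fixes G :: "'h \<Rightarrow> 'v \<Rightarrow> 'm::ab_group_add"
  assumes G: "\<And>v. Vector_Spaces.linear sH r (\<lambda>h. G h v)" "\<And>h. Vector_Spaces.linear sV r (\<lambda>v. G h v)"
  obtains L where "\<And>m n. L (m + n) = L m + L n" "\<And>h v. L (la h (e v)) = G h v"
proof -
  define sm where "sm t = (\<Sum>(h, g)\<in>#t. sw g (\<lambda>a b. G (h * a) (P b)))" for t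
  have GH [linear_rules]: "Vector_Spaces.linear q r (\<lambda>x. G (f x) v)"
    if "Vector_Spaces.linear q sH f" for q v and f :: "'y::ab_group_add \<Rightarrow> 'h"
    using linear_comp[OF G(1) that] .
  have GV [linear_rules]: "Vector_Spaces.linear q r (\<lambda>x. G h (f x))"
    if "Vector_Spaces.linear q sV f" for q h and f :: "'y::ab_group_add \<Rightarrow> 'v"
    using linear_comp[OF G(2) that] .
  define L where "L w = sm (SOME t. t \<in> OmegaU1 \<and> proj1 C t = w)" for w
  have sm_add: "sm (t + u) = sm t + sm u" for t u
    by (simp add: sm_def)
  have sm_NH: "sm t = 0" if t: "t \<in> NH C" for t
  proof -
    obtain z where z: "set_mset z \<subseteq> UNIV \<times> QH C"
      "ktensor_eq sH sH (\<Sum>(h, g)\<in>#t. image_mset (\<lambda>(g1, g2). (h * g1, g2)) (comult C g)) z"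
      using t unfolding NH_def by blast
    have "sm t = (\<Sum>(a, b)\<in>#(\<Sum>(h, g)\<in>#t. image_mset (\<lambda>(g1, g2). (h * g1, g2)) (comult C g)). G a (P b))"
      unfolding sm_def sum_mset_sum_mset case_prod_unfold
      by (simp add: sweedler_def image_mset.compositionality comp_def case_prod_unfold)
    also have "\<dots> = (\<Sum>(a, b)\<in>#z. G a (P b))"
      by (rule sweedler_sum_eq[OF z(2), where r = r]) (intro linear_rules GH GV)+
    also have "\<dots> = (\<Sum>p\<in>#z. 0)"
      using z(1) by (intro arg_cong[where f = sum_mset] image_mset_cong)
        (auto simp: P_Q linear_zero[OF G(2)])
    finally show ?thesis by simp
  qed
  have sm_eq: "sm t = sm u" if tu: "t \<in> OmegaU1" "u \<in> OmegaU1" "proj1 C t = proj1 C u" for t u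
  proof -
    \<comment> \<open>Left multiplication by -1 stands in for the negative of a formal sum, so that
      \<open>proj1_la\<close> computes its class.\<close>
    let ?u = "image_mset (\<lambda>(a, b). (- 1 * a, b)) u"
    have mem: "?u \<in> OmegaU1"
    proof -
      have "(\<Sum>(a, b)\<in>#image_mset (\<lambda>(a, b). (- 1 * a, b)) t. a * b) = - (\<Sum>(a, b)\<in>#t. a * b)"
        for t :: "('h \<times> 'h) multiset"
        by (induction t) auto
      moreover have "(\<Sum>(a, b)\<in>#u. a * b) = 0"
        using tu(2) unfolding OmegaU1_def by (rule CollectD)
      ultimately show ?thesis unfolding OmegaU1_def by (intro CollectI) (simp only: minus_zero)
    qed
    have "proj1 C (t + ?u) = 0"
      unfolding proj1_add[OF tu(1) mem] proj1_la[OF tu(2)] la_neg using tu(3) by simp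
    then have "t + ?u \<in> NH C"
      by (rule iffD1[OF proj1_eq_0[OF OmegaU1_add[OF tu(1) mem]]])
    then have "sm t + sm ?u = 0"
      unfolding sm_add[symmetric] by (rule sm_NH)
    moreover have "sm ?u + sm u = 0"
    proof -
      have neg: "G (- x) v + G x v = 0" for x v
        using linear_add[OF G(1), of "- x" x v] linear_zero[OF G(1), of v] by simp
      have "sw g (\<lambda>a b. G (- (h * a)) (P b)) + sw g (\<lambda>a b. G (h * a) (P b)) = 0" for g h
        unfolding sweedler_add[symmetric] by (simp add: neg sweedler_def case_prod_unfold)
      then have "sm {#(- fst p, snd p)#} + sm {#p#} = 0" for p
        by (simp add: sm_def case_prod_unfold)
      then have "(\<Sum>p\<in>#u. sm {#(- fst p, snd p)#} + sm {#p#}) = 0"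
        by simp
      then show ?thesis
        by (simp add: sum_mset.distrib sm_def case_prod_unfold image_mset.compositionality comp_def)
    qed
    ultimately show ?thesis by (simp add: add_eq_0_iff)
  qed
  have L: "L (proj1 C t) = sm t" if "t \<in> OmegaU1" for t
    unfolding L_def using someI[of "\<lambda>u. u \<in> OmegaU1 \<and> proj1 C u = proj1 C t" t] that
    by (intro sm_eq) auto
  have lin1: "Vector_Spaces.linear sH r (\<lambda>x. G (h * x) v)" for h v
    by (intro GH linear_rules)
  show thesis
  proof
    fix m n
    obtain t u where t: "t \<in> OmegaU1" "proj1 C t = m" and u: "u \<in> OmegaU1" "proj1 C u = n"
      using proj1_surj by metis
    show "L (m + n) = L m + L n"
      using L[OF t(1)] L[OF u(1)] L[OF OmegaU1_add[OF t(1) u(1)]] proj1_add[OF t(1) u(1)] t(2) u(2)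
      by (simp add: sm_add)
  next
    fix h v
    let ?g = "lift0 C v"
    let ?t = "image_mset (\<lambda>(a, b). (S a, b)) (comult C ?g)"
    let ?u = "image_mset (\<lambda>(a, b). (h * a, b)) ?t"
    have u: "?u \<in> OmegaU1"
    proof -
      have "(\<Sum>(a, b)\<in>#image_mset (\<lambda>(a, b). (h * a, b)) t. a * b) = h * (\<Sum>(a, b)\<in>#t. a * b)" for t
        by (induction t) (simp_all add: case_prod_unfold mult.assoc distrib_left)
      then show ?thesis using maurer_cartan_representative(1)[OF lift0(1)] by (simp add: OmegaU1_def)
    qed
    have "la h (e v) = proj1 C ?u"
      by (simp only: proj1_la maurer_cartan_representative lift0 e_eq_maurer_cartan_lift)
    then have "L (la h (e v)) = sm ?u" using L[OF u] by simp
    \<comment> \<open>On h S(g_1) \<otimes> g_2 the formula reads G(h S(g_1) g_2, pi g_3), and the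
      antipode axiom absorbs the first two legs.\<close>
    also have "\<dots> = sw ?g (\<lambda>a y. sw y (\<lambda>b c. G (h * (S a * b)) (P c)))"
      by (simp add: sm_def sweedler_def image_mset.compositionality comp_def case_prod_unfold mult.assoc)
    also have "\<dots> = sw ?g (\<lambda>y c. sw y (\<lambda>a b. G (h * (S a * b)) (P c)))"
      by (intro coassoc[symmetric, where r = r] linear_rules GH GV)
    also have "\<dots> = sw ?g (\<lambda>y c. G (h * sw y (\<lambda>a b. S a * b)) (P c))"
      by (simp add: sweedler_linear[OF lin1])
    also have "\<dots> = sw ?g (\<lambda>y c. r (\<epsilon> y) (G h (P c)))"
      by (simp add: antipode_left scale_mult linear_scale[OF G(1)])
    also have "\<dots> = G h (P ?g)"
      by (intro counit_left_linear(2) linear_rules GV)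
    finally show "L (la h (e v)) = G h v" by simp
  qed
qed

section \<open>Coaction identities and Ad-invariant tensors\<close>

lemma linear_scaleV [linear_rules]:
  "Vector_Spaces.linear q sV f \<Longrightarrow> Vector_Spaces.linear q sV (\<lambda>x. sV c (f x))"
  "Vector_Spaces.linear q (*) g \<Longrightarrow> Vector_Spaces.linear q sV (\<lambda>x. sV (g x) v)"
  by (simp_all add: Vector_Spaces.linear_iff algebra_simps V.scale_left_distrib V.scale_right_distrib
    V.vector_space_axioms)

lemma linear_coact_sum [linear_rules]:
  assumes "Vector_Spaces.linear q sV f"
    and "\<And>y. Vector_Spaces.linear sV r (\<lambda>x. F x y)" "\<And>x. Vector_Spaces.linear sH r (\<lambda>y. F x y)"
  shows "Vector_Spaces.linear q r (\<lambda>x. coact_sum (f x) F)"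
  using linear_comp[OF coact_sum_linear[OF assms(2,3)] assms(1)] .

lemma linear_coact_sum_body [linear_rules]:
  assumes "\<And>a b. Vector_Spaces.linear q r (\<lambda>x. F x a b)"
  shows "Vector_Spaces.linear q r (\<lambda>x. coact_sum v (F x))"
  using assms unfolding coact_sum_def case_prod_unfold by (rule linear_sum_mset_body)

lemma coact_sum_swap: "coact_sum v (\<lambda>a b. coact_sum w (\<lambda>c d. F a b c d)) = coact_sum w (\<lambda>c d. coact_sum v (\<lambda>a b. F a b c d))"
  unfolding coact_sum_def case_prod_unfold by (rule sum_mset.swap)

lemma coact_sum_out: "Vector_Spaces.linear r t f \<Longrightarrow> f (coact_sum v F) = coact_sum v (\<lambda>a b. f (F a b))"
  by (simp add: coact_sum_def linear_sum_mset case_prod_unfold)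

text \<open>In Sweedler notation v_0 \<otimes> S(v_1) v_2 = v \<otimes> 1. For a lift g the
  coalgebra leg is S(g_4) S(g_1 S(g_2)) g_5: first g_1 S(g_2) cancels, then S(g_4) g_5, and g_3
  remains.\<close>

lemma coact_sum_coact_sum_antipode:
  assumes G: "\<And>y. Vector_Spaces.linear sV r (\<lambda>x. G x y)" "\<And>x. Vector_Spaces.linear sH r (\<lambda>y. G x y)"
  shows "coact_sum v (\<lambda>v0 v1. coact_sum v0 (\<lambda>a b. G a (S b * v1))) = G v 1"
proof -
  have GV: "Vector_Spaces.linear q r (\<lambda>x. G (f x) y)"
    if "Vector_Spaces.linear q sV f" for q y and f :: "'y::ab_group_add \<Rightarrow> 'v"
    using linear_comp[OF G(1) that] .
  have GH: "Vector_Spaces.linear q r (\<lambda>x. G y (f x))"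
    if "Vector_Spaces.linear q sH f" for q y and f :: "'y::ab_group_add \<Rightarrow> 'h"
    using linear_comp[OF G(2) that] .
  let ?g = "lift0 C v"
  define K where "K h y = sw y (\<lambda>z c. sw z (\<lambda>q t. G (P q) (S t * S h * c)))" for h y
  have KH: "Vector_Spaces.linear q r (\<lambda>x. K (f x) y)"
    if "Vector_Spaces.linear q sH f" for q y and f :: "'y::ab_group_add \<Rightarrow> 'h"
    unfolding K_def by (intro linear_rules GV GH that)
  have KY: "Vector_Spaces.linear q r (\<lambda>x. K h (f x))"
    if "Vector_Spaces.linear q sH f" for q h and f :: "'y::ab_group_add \<Rightarrow> 'h"
    unfolding K_def by (intro linear_rules GV GH that)
  have "coact_sum v (\<lambda>v0 v1. coact_sum v0 (\<lambda>a b. G a (S b * v1))) =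
    sw ?g (\<lambda>a y. sw y (\<lambda>b c. coact_sum (P b) (\<lambda>u w. G u (S w * (S a * c)))))"
    by (rule coact_sum_lift0)
  also have "\<dots> = sw ?g (\<lambda>a y. sw y (\<lambda>b c. sw b (\<lambda>p z. sw z (\<lambda>q t.
      G (P q) (S t * S (a * S p) * c)))))"
  proof -
    have "coact_sum (P b) (\<lambda>u w. G u (S w * x)) = sw b (\<lambda>p z. sw z (\<lambda>q t. G (P q) (S (S p * t) * x)))" for b x
      by (intro coact_sum_P[where r = r] linear_rules GV GH)
    then show ?thesis by (simp add: antipode_mult mult.assoc)
  qed
  also have "\<dots> = sw ?g (\<lambda>a y. sw y (\<lambda>p y'. K (a * S p) y'))"
    unfolding K_def
    by (intro arg_cong[where f = "sw ?g"] ext coassoc[where r = r] linear_rules GV GH)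
  also have "\<dots> = sw ?g (\<lambda>x y'. sw x (\<lambda>a p. K (a * S p) y'))"
    by (intro coassoc[symmetric, where r = r] linear_rules KH KY)
  also have "\<dots> = sw ?g (\<lambda>x y'. r (\<epsilon> x) (K 1 y'))"
    by (simp add: sweedler_linear[OF KH[OF linear_id], symmetric] antipode_right
        linear_scale[OF KH[OF linear_id]])
  also have "\<dots> = K 1 ?g"
    by (intro counit_left_linear(2) KY linear_rules)
  also have "\<dots> = sw ?g (\<lambda>q y. sw y (\<lambda>t c. G (P q) (S t * c)))"
    unfolding K_def antipode_one mult_1_right by (intro coassoc[where r = r] linear_rules GV GH)
  also have "\<dots> = sw ?g (\<lambda>q y. r (\<epsilon> y) (G (P q) 1))"
    by (simp add: sweedler_linear[OF G(2), symmetric] antipode_left linear_scale[OF G(2)])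
  also have "\<dots> = G v 1"
    using counit_right_linear(2)[of r "\<lambda>q. G (P q) 1" ?g] by (simp add: GV linear_P linear_id)
  finally show ?thesis .
qed

text \<open>With v_0 \<otimes> v_1 = g_2 \<otimes> S(g_1) g_3 the action yields g_2 S(g_3) S^2(g_1),
  and the first pair cancels.\<close>

lemma coact_sum_act0_antipode: "coact_sum v (\<lambda>a b. act0 C a (S b)) = Ssq0 C v"
proof -
  let ?g = "lift0 C v"
  have PH: "Vector_Spaces.linear sH sV (\<lambda>x. P (x * h))" "Vector_Spaces.linear sH sV (\<lambda>x. P (S (x * h)))"
    "Vector_Spaces.linear sH sV (\<lambda>x. P (S (h * x)))" "Vector_Spaces.linear sH sV (\<lambda>x. P (S x))"
    "Vector_Spaces.linear sH sV (\<lambda>x. P (S (S x)))" for h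
    by (intro linear_rules)+
  \<comment> \<open>The extra sum is the counit correction from \<open>act0_P\<close>; it vanishes
    because S(g_1) g_2 = \<epsilon>(g) 1 with \<epsilon>(g) = 0.\<close>
  have "coact_sum v (\<lambda>a b. act0 C a (S b)) + sw ?g (\<lambda>a y. sw y (\<lambda>b c. sV (\<epsilon> b) (P (S (S a * c))))) =
      sw ?g (\<lambda>a y. sw y (\<lambda>b c. P (b * S c * S (S a))))"
  proof -
    have act: "act0 C (P b) (S (S a * c)) + sV (\<epsilon> b) (P (S (S a * c))) = P (b * S c * S (S a))"
      for a b c by (simp add: act0_P antipode_mult mult.assoc)
    show ?thesis
      unfolding coact_sum_lift0 sweedler_add[symmetric] act ..
  qed
  also have "\<dots> = sw ?g (\<lambda>a y. sV (\<epsilon> y) (P (S (S a))))"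
    by (simp add: sweedler_linear[OF PH(1), symmetric] antipode_right scale_mult
        linear_scale[OF P_linear])
  also have "\<dots> = P (S (S ?g))"
    by (rule counit_right_linear(2)[OF PH(5)])
  also have "sw ?g (\<lambda>a y. sw y (\<lambda>b c. sV (\<epsilon> b) (P (S (S a * c))))) = 0"
  proof -
    have "sw ?g (\<lambda>a y. sw y (\<lambda>b c. sV (\<epsilon> b) (P (S (S a * c))))) = sw ?g (\<lambda>a y. P (S (S a * y)))"
      by (simp add: counit_left_linear(2)[OF PH(3)])
    also have "\<dots> = P (S (sw ?g (\<lambda>a y. S a * y)))"
      by (simp add: sweedler_linear[OF PH(4)])
    also have "\<dots> = 0"
      using linear_zero[OF PH(4)] by (simp add: antipode_left lift0)
    finally show ?thesis .
  qed
  finally show ?thesis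
    by (simp add: Ssq0_def P_proj0 counit_antipode lift0)
qed

text \<open>A general trilinear F lets this serve both \<open>Psi\<close> and the cotorsion.
  Invariance is evaluated on a G that coacts once more on the first leg and multiplies by the
  antipode: one side cancels by \<open>coact_sum_coact_sum_antipode\<close>, the other keeps
  S(x_1).\<close>

lemma Ad_invariant_sum:
  assumes inv: "Ad_invariant C eta"
    and F: "\<And>y z. Vector_Spaces.linear sV r (\<lambda>x. F x y z)"
    "\<And>x z. Vector_Spaces.linear sV r (\<lambda>y. F x y z)" "\<And>x y. Vector_Spaces.linear sH r (\<lambda>z. F x y z)"
  shows "(\<Sum>(x, y)\<in>#eta. coact_sum y (\<lambda>y0 y1. F x y0 y1)) = (\<Sum>(x, y)\<in>#eta. coact_sum x (\<lambda>x0 x1. F x0 y (S x1)))"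
proof -
  have F1: "Vector_Spaces.linear q r (\<lambda>x. F (f x) y z)"
    if "Vector_Spaces.linear q sV f" for q y z and f :: "'y::ab_group_add \<Rightarrow> 'v"
    using linear_comp[OF F(1) that] .
  have F2: "Vector_Spaces.linear q r (\<lambda>x. F y (f x) z)"
    if "Vector_Spaces.linear q sV f" for q y z and f :: "'y::ab_group_add \<Rightarrow> 'v"
    using linear_comp[OF F(2) that] .
  have F3: "Vector_Spaces.linear q r (\<lambda>x. F y z (f x))"
    if "Vector_Spaces.linear q sH f" for q y z and f :: "'y::ab_group_add \<Rightarrow> 'h"
    using linear_comp[OF F(3) that] .
  define G where "G v w h = coact_sum v (\<lambda>v0 v1. F v0 w (S v1 * h))" for v w h
  let ?t = "\<Sum>(x, y)\<in>#eta. \<Sum>(x0, x1)\<in>#coact0 C x. image_mset (\<lambda>(y0, y1). (x0, y0, x1 * y1)) (coact0 C y)"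
  have "(\<Sum>(a, b, c)\<in>#?t. G a b c) = (\<Sum>(a, b, c)\<in>#image_mset (\<lambda>(x, y). (x, y, 1)) eta. G a b c)"
    using inv unfolding Ad_invariant_def
    by (rule tensor3_sum_eq[where r = r]) (unfold G_def, (intro linear_rules F1 F2 F3)+)
  also have "(\<Sum>(a, b, c)\<in>#?t. G a b c) =
      (\<Sum>(x, y)\<in>#eta. coact_sum x (\<lambda>x0 x1. coact_sum y (\<lambda>y0 y1. G x0 y0 (x1 * y1))))"
    unfolding case_prod_unfold sum_mset_sum_mset coact_sum_def
    by (simp add: image_mset.compositionality comp_def)
  also have "\<dots> = (\<Sum>(x, y)\<in>#eta. coact_sum y (\<lambda>y0 y1. F x y0 y1))"
  proof -
    have "coact_sum x (\<lambda>x0 x1. coact_sum y (\<lambda>y0 y1. G x0 y0 (x1 * y1))) = coact_sum y (\<lambda>y0 y1. F x y0 y1)" for x y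
    proof -
      have *: "coact_sum x (\<lambda>x0 x1. G x0 y0 (x1 * y1)) = F x y0 y1" for y0 y1
        unfolding G_def
        using coact_sum_coact_sum_antipode[where G = "\<lambda>v h. F v y0 (h * y1)" and r = r and v = x]
        by (simp add: F1 F3 linear_rules mult.assoc)
      show ?thesis by (subst coact_sum_swap) (simp add: *)
    qed
    then show ?thesis by simp
  qed
  finally show ?thesis
    by (simp add: image_mset.compositionality comp_def case_prod_unfold G_def)
qed

section \<open>Dual bases and injectivity of e \<otimes> e\<close>

lemma dual_basis_expansion:
  assumes "dual_bases C B F"
  shows "v = (\<Sum>b\<in>B. sV (F b v) b)"
proof -
  have B: "finite B" "V.span B = UNIV"
    and F: "\<And>b. b \<in> B \<Longrightarrow> Vector_Spaces.linear sV (*) (F b)"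
    "\<And>b b'. b \<in> B \<Longrightarrow> b' \<in> B \<Longrightarrow> F b b' = (if b = b' then 1 else 0)"
    using assms by (auto simp: dual_bases_def dual0_def)
  define f where "f v = (\<Sum>b\<in>B. sV (F b v) b)" for v
  have "f (v + w) = f v + f w" "f (sV c v) = sV c (f v)" for v w c
    unfolding f_def by (simp_all add: linear_add[OF F(1)] linear_scale[OF F(1)]
        V.scale_left_distrib sum.distrib V.scale_sum_right)
  moreover from this(2)[of 0 0] have "f 0 = 0" by simp
  ultimately have "V.subspace {v. f v = v}"
    by (intro V.subspaceI) simp_all
  moreover have "f b = b" if "b \<in> B" for b
  proof -
    have "f b = (\<Sum>b'\<in>B. if b' = b then b else 0)"
      unfolding f_def using that by (intro sum.cong) (auto simp: F(2))
    then show ?thesis using that B(1) by simp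
  qed
  ultimately have "f v = v"
    using V.span_induct[of v B "\<lambda>v. f v = v"] B(2) by simp
  then show ?thesis by (simp add: f_def)
qed

lemma dual_bases_exist:
  assumes "finite_dimensional sV"
  obtains B F where "dual_bases C B F"
proof -
  obtain B0 where B0: "finite B0" "V.span B0 = UNIV"
    using assms unfolding finite_dimensional_def by blast
  obtain B where B: "V.independent B" "UNIV \<subseteq> V.span B"
    using V.maximal_independent_subset[of UNIV] by blast
  have fin: "finite B"
    using V.independent_span_bound[OF B0(1) B(1)] B0(2) by simp
  have sp: "V.span B = UNIV" using B(2) by blast
  have "Vector_Spaces.linear sV (*) (\<lambda>v. V.representation B v b)" for b
    using V.representation_add[OF B(1)] V.representation_scale[OF B(1)] sp
    by (simp add: Vector_Spaces.linear_iff V.vector_space_axioms vector_space_field)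
  moreover have "V.representation B b' b = (if b = b' then 1 else 0)" if "b' \<in> B" for b b'
    using V.representation_basis[OF B(1) that] by auto
  ultimately have "dual_bases C B (\<lambda>b v. V.representation B v b)"
    using B(1) fin sp by (simp add: dual_bases_def dual0_def)
  then show thesis by (rule that)
qed

lemma V_separated:
  assumes "dual_bases C B F" "\<And>f. f \<in> dual0 C \<Longrightarrow> f v = f w"
  shows "v = w"
proof -
  have "F b v = F b w" if "b \<in> B" for b
    using assms that by (simp add: dual_bases_def)
  then show ?thesis
    using dual_basis_expansion[OF assms(1), of v] dual_basis_expansion[OF assms(1), of w] by simp
qed

lemma V_tensor_eqI:
  assumes "dual_bases C B F"
    and "\<And>f. f \<in> dual0 C \<Longrightarrow> (\<Sum>(m, n)\<in>#t. sV (f m) n) = (\<Sum>(m, n)\<in>#u. sV (f m) n)"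
  shows "ktensor_eq sV sV t u"
  using assms dual_basis_expansion[OF assms(1)]
  by (intro tensor_eq_onI_coordinates[where B = B and u = id and c = F]) (auto simp: dual_bases_def)

text \<open>A scalar c crosses the tensor product over H as c 1, on which the left and right actions
  agree.\<close>

lemma Omega11_eq_e:
  assumes "ktensor_eq sV sV t u"
  shows "tensor_eq ra la (image_mset (\<lambda>(x, y). (e x, e y)) t) (image_mset (\<lambda>(x, y). (e x, e y)) u)"
proof -
  have base: "tensor_eq ra la (\<Sum>(x, y)\<in>#t. {#(e x, e y)#}) (\<Sum>(x, y)\<in>#u. {#(e x, e y)#})"
    if "tensor_relation UNIV UNIV (\<lambda>a c. sV c a) sV t u" for t u
    using that
  proof cases
    case (add_left m m' n)
    then show ?thesis
      using tensor_eq_add_left[of "e m" UNIV "e m'" ra la "e n"]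
      by (simp add: linear_add[OF e_linear] add_mset_commute)
  next
    case (add_right m n n')
    then show ?thesis
      using tensor_eq_add_right[of "e m" UNIV ra la "e n" "e n'"]
      by (simp add: linear_add[OF e_linear] add_mset_commute)
  next
    case (zero n)
    then show ?thesis
      using tensor_eq_zero_left[of UNIV ra la "e n"] by (simp add: linear_zero[OF e_linear])
  next
    case (balanced m n c)
    have "tensor_eq ra la {#(ra (e m) (sH c 1), e n)#} {#(e m, la (sH c 1) (e n))#}"
      by (intro additive_congruence.base tensor_relation.balanced) simp_all
    then show ?thesis using balanced
      by (simp add: linear_scale[OF e_linear] flip: sW_ra scale1_def)
  qed
  show ?thesis
    using additive_congruence_lift[OF assms base] by (simp add: case_prod_unfold)
qed

lemma dual0_linear: "f \<in> dual0 C \<Longrightarrow> Vector_Spaces.linear sV (*) f"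
  by (simp add: dual0_def)

lemma linear_dual:
  "f \<in> dual0 C \<Longrightarrow> Vector_Spaces.linear q sV g \<Longrightarrow> Vector_Spaces.linear q (*) (\<lambda>x. f (g x))"
  by (rule linear_comp[OF dual0_linear])

text \<open>Freeness is applied to (h, v) |-> f(v) h; left linearity holds because the forms h e(v)
  generate.\<close>

lemma left_coordinate:
  assumes f: "f \<in> dual0 C"
  obtains L where "\<And>m n. L (m + n) = L m + L n" "\<And>h m. L (la h m) = h * L m"
    "\<And>v. L (e v) = sH (f v) 1"
proof -
  obtain L where L: "\<And>m n. L (m + n) = L m + L n" "\<And>h v. L (la h (e v)) = sH (f v) h"
    by (rule extend_from_left_basis[of sH "\<lambda>h v. sH (f v) h"])
      (intro linear_rules linear_dual f | blast)+
  have L0: "L 0 = 0" using L(1)[of 0 0] by simp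
  have "L (la h m) = h * L m" for h m
  proof -
    obtain t where t: "m = (\<Sum>(h, v)\<in>#t. la h (e v))" using left_generated by blast
    have "L (\<Sum>(a, v)\<in>#t. la (h * a) (e v)) = h * L (\<Sum>(a, v)\<in>#t. la a (e v))"
      by (induction t) (auto simp: L L0 scale_mult distrib_left)
    moreover have "la h m = (\<Sum>(a, v)\<in>#t. la (h * a) (e v))"
      unfolding t linear_sum_mset[OF linear_la(2)[OF linear_idW]]
      by (simp add: case_prod_unfold la_mult)
    ultimately show ?thesis by (simp add: t)
  qed
  moreover have "L (e v) = sH (f v) 1" for v
    using L(2)[of 1 v] by simp
  ultimately show thesis using L(1) that by blast
qed

text \<open>For left coordinates L, M of functionals f, k the pairing m \<otimes> n |-> L(m M(n)) is
  balanced because M is left linear. On e(x) \<otimes> e(y) it takes the value f(x) k(y) 1, and such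
  products separate tensors over the field.\<close>

lemma e_tensor_inject:
  assumes B: "dual_bases C B F"
    and eq: "tensor_eq ra la (image_mset (\<lambda>(x, y). (e x, e y)) t) (image_mset (\<lambda>(x, y). (e x, e y)) u)"
  shows "ktensor_eq sV sV t u"
proof (rule V_tensor_eqI[OF B])
  fix f assume f: "f \<in> dual0 C"
  show "(\<Sum>(m, n)\<in>#t. sV (f m) n) = (\<Sum>(m, n)\<in>#u. sV (f m) n)"
  proof (rule V_separated[OF B])
    fix k assume k: "k \<in> dual0 C"
    obtain L where L: "\<And>m n. L (m + n) = L m + L n" "\<And>h m. L (la h m) = h * L m"
      "\<And>v. L (e v) = sH (f v) 1" using left_coordinate[OF f] by blast
    obtain M where M: "\<And>m n. M (m + n) = M m + M n" "\<And>h m. M (la h m) = h * M m"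
      "\<And>v. M (e v) = sH (k v) 1" using left_coordinate[OF k] by blast
    have "(\<Sum>(m, n)\<in>#image_mset (\<lambda>(x, y). (e x, e y)) t. L (ra m (M n))) =
        (\<Sum>(m, n)\<in>#image_mset (\<lambda>(x, y). (e x, e y)) u. L (ra m (M n)))"
      by (rule tensor_eq_sum_eq[OF eq]) (simp_all add: ra_add L M ra_mult)
    moreover have "L (ra (e x) (M (e y))) = sH (f x * k y) 1" for x y
      by (simp add: L M flip: sW_ra) (simp add: scale1_def L scale_mult mult.commute)
    ultimately have "(\<Sum>(x, y)\<in>#t. sH (f x * k y) 1) = (\<Sum>(x, y)\<in>#u. sH (f x * k y) 1)"
      by (simp add: image_mset.compositionality comp_def case_prod_unfold)
    \<comment> \<open>The counit reads off the scalar in front of 1.\<close>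
    from arg_cong[OF this, of \<epsilon>]
    have "(\<Sum>(x, y)\<in>#t. f x * k y) = (\<Sum>(x, y)\<in>#u. f x * k y)"
      by (simp add: linear_sum_mset[OF counit_linear] case_prod_unfold)
    then show "k (\<Sum>(m, n)\<in>#t. sV (f m) n) = k (\<Sum>(m, n)\<in>#u. sV (f m) n)"
      by (simp add: linear_sum_mset[OF dual0_linear[OF k]] linear_scale[OF dual0_linear[OF k]]
          case_prod_unfold)
  qed
qed

text \<open>
  The functional \<open>L\<close> below inverts \<open>v \<otimes> h \<mapsto> e(v) h = h\<^sub>1 e(v \<cdot> h\<^sub>2)\<close>, because
  \<open>h\<^sub>3 S\<^sup>-\<^sup>1(h\<^sub>2) \<otimes> h\<^sub>1 = 1 \<otimes> h\<close>.
\<close>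

lemma right_coordinate:
  assumes f: "f \<in> dual0 C"
  obtains L where "\<And>m n. L (m + n) = L m + L n" "\<And>v h. L (ra (e v) h) = sH (f v) h"
proof -
  let ?G = "\<lambda>h v. sw h (\<lambda>a b. sH (f (act0 C v (T b))) a)"
  obtain L where L: "\<And>m n. L (m + n) = L m + L n" "\<And>h v. L (la h (e v)) = ?G h v"
    by (rule extend_from_left_basis[of sH ?G]) (intro linear_rules linear_dual f | blast)+
  have L0: "L 0 = 0" using L(1)[of 0 0] by simp
  have fH: "Vector_Spaces.linear sH sH (\<lambda>x. sH (f (act0 C v x)) a)" for v a
    by (intro linear_rules linear_dual f)
  have "L (ra (e v) h) = sH (f v) h" for v h
  proof -
    have "L (ra (e v) h) = sw h (\<lambda>x c. L (la x (e (act0 C v c))))"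
    proof -
      have "L (\<Sum>p\<in>#I. g p) = (\<Sum>p\<in>#I. L (g p))" for I and g :: "'h \<times> 'h \<Rightarrow> 'w"
        by (induction I) (simp_all add: L(1) L0)
      then show ?thesis by (simp add: e_ra sweedler_def case_prod_unfold)
    qed
    also have "\<dots> = sw h (\<lambda>x c. sw x (\<lambda>a b. sH (f (act0 C v (c * T b))) a))"
      by (simp add: L act0_mult)
    also have "\<dots> = sw h (\<lambda>a y. sw y (\<lambda>b c. sH (f (act0 C v (c * T b))) a))"
      by (intro coassoc[where r = sH] linear_rules linear_dual f)
    also have "\<dots> = sw h (\<lambda>a y. sH (f (act0 C v (sw y (\<lambda>b c. c * T b)))) a)"
      by (simp add: sweedler_linear[OF fH])
    also have "\<dots> = sw h (\<lambda>a y. sH (\<epsilon> y) (sH (f v) a))"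
      by (simp add: T_right act0_scale act0_one linear_scale[OF dual0_linear[OF f]])
    also have "\<dots> = sH (f v) h"
      by (intro counit_right_linear(2) linear_rules)
    finally show ?thesis .
  qed
  then show thesis using L(1) that by blast
qed

section \<open>The coframing, its metric and the dual coaction\<close>

lemma zero_dual0: "0 \<in> dual0 C"
  and add_dual0: "f \<in> dual0 C \<Longrightarrow> g \<in> dual0 C \<Longrightarrow> f + g \<in> dual0 C"
  and minus_dual0: "f \<in> dual0 C \<Longrightarrow> - f \<in> dual0 C"
  and scale_dual0: "f \<in> dual0 C \<Longrightarrow> dual_scale c f \<in> dual0 C"
  by (simp_all add: dual0_def Vector_Spaces.linear_iff dual_scale_def algebra_simps)
    (simp_all add: V.vector_space_axioms vector_space_field)

lemma sum_dual0: "(\<And>b. G b \<in> dual0 C) \<Longrightarrow> (\<Sum>b\<in>B. G b) \<in> dual0 C"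
  by (induction B rule: infinite_finite_induct)
    (simp_all only: sum.infinite sum.empty sum.insert zero_dual0 add_dual0 not_False_eq_True)

lemma eta_map_add: "eta_map C eta (f + g) = eta_map C eta f + eta_map C eta g"
  by (simp add: eta_map_def V.scale_left_distrib sum_mset.distrib case_prod_unfold)

lemma eta_map_scale: "eta_map C eta (dual_scale c f) = sV c (eta_map C eta f)"
  unfolding eta_map_def dual_scale_def
  by (simp add: linear_sum_mset[OF linear_scaleV(1)[OF linear_idV]] case_prod_unfold)

lemma eta_map_zero: "eta_map C eta 0 = 0"
  using eta_map_add[of eta 0 0] by simp

text \<open>As \<eta> identifies the dual of Omega_0 with Omega_0, only e matters: surjectivity
  comes from right generation by \<open>la_e\<close>, injectivity from
  \<open>right_coordinate\<close>.\<close>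

lemma coframing_eta:
  assumes B: "dual_bases C B F" and nondeg: "nondegenerate C eta"
  shows "coframing C (e \<circ> eta_map C eta)"
proof -
  let ?E = "eta_map C eta"
  have bij: "bij_betw ?E (dual0 C) UNIV"
    using nondeg by (simp add: nondegenerate_def)
  define J where "J = inv_into (dual0 C) ?E"
  have J: "J v \<in> dual0 C" "?E (J v) = v" for v
    using bij inv_into_into[of v ?E "dual0 C"] f_inv_into_f[of v ?E "dual0 C"]
    by (simp_all add: J_def bij_betw_def)
  have E_inj: "f = g" if "f \<in> dual0 C" "g \<in> dual0 C" "?E f = ?E g" for f g
    using bij that by (auto simp: bij_betw_def inj_on_def)
  have surj: "\<exists>t. set_mset t \<subseteq> dual0 C \<times> UNIV \<and> m = (\<Sum>(f, h)\<in>#t. ra (e (?E f)) h)" for m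
  proof -
    obtain s where s: "m = (\<Sum>(h, v)\<in>#s. la h (e v))" using left_generated by blast
    \<comment> \<open>Each h e(v) is rewritten by \<open>la_e\<close>, and J supplies the covector
      over v . S^-1(h_2).\<close>
    let ?t = "\<Sum>(h, v)\<in>#s. image_mset (\<lambda>(a, b). (J (act0 C v (T b)), a)) (comult C h)"
    have "set_mset ?t \<subseteq> dual0 C \<times> UNIV"
      by (induction s) (auto simp: J(1))
    moreover have "m = (\<Sum>(f, h)\<in>#?t. ra (e (?E f)) h)"
      unfolding s sum_mset_sum_mset case_prod_unfold
      by (simp add: la_e J sweedler_def image_mset.compositionality comp_def case_prod_unfold)
    ultimately show ?thesis by blast
  qed
  have inj: "tensor_eq_on (dual0 C) UNIV (\<lambda>f c. dual_scale c f) sH t u"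
    if t: "set_mset t \<subseteq> dual0 C \<times> UNIV" and u: "set_mset u \<subseteq> dual0 C \<times> UNIV"
      and eq: "(\<Sum>(f, h)\<in>#t. ra (e (?E f)) h) = (\<Sum>(f, h)\<in>#u. ra (e (?E f)) h)" for t u
  \<comment> \<open>The preimages J b of the basis span the dual, with coordinates f |-> F b (\<eta>
    f); these are read off from one-forms by the right coordinate of F b.\<close>
  proof (rule tensor_eq_onI_coordinates[where B = B and u = J and c = "\<lambda>b f. F b (?E f)"])
    show "finite B" using B by (simp add: dual_bases_def)
    show "f = (\<Sum>b\<in>B. dual_scale (F b (?E f)) (J b))" if f: "f \<in> dual0 C" for f
    proof (rule E_inj[OF f])
      have E_sum: "?E (\<Sum>b\<in>B. g b) = (\<Sum>b\<in>B. ?E (g b))" for g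
        by (induction B rule: infinite_finite_induct) (simp_all only: sum.infinite sum.empty sum.insert eta_map_zero eta_map_add not_False_eq_True)
      show "(\<Sum>b\<in>B. dual_scale (F b (?E f)) (J b)) \<in> dual0 C"
        by (intro sum_dual0 scale_dual0 J(1))
      show "?E f = ?E (\<Sum>b\<in>B. dual_scale (F b (?E f)) (J b))"
        unfolding E_sum eta_map_scale J(2) by (rule dual_basis_expansion[OF B])
    qed
    fix b assume "b \<in> B"
    then have "F b \<in> dual0 C" using B by (simp add: dual_bases_def)
    then obtain L where L: "\<And>m n. L (m + n) = L m + L n" "\<And>v h. L (ra (e v) h) = sH (F b v) h"
      using right_coordinate by blast
    have L0: "L 0 = 0" using L(1)[of 0 0] by simp
    have "L (\<Sum>(f, h)\<in>#t. ra (e (?E f)) h) = (\<Sum>(f, h)\<in>#t. sH (F b (?E f)) h)" for t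
      by (induction t) (auto simp: L L0)
    then show "(\<Sum>(m, n)\<in>#t. sH (F b (?E m)) n) = (\<Sum>(m, n)\<in>#u. sH (F b (?E m)) n)"
      using eq by metis
  qed (use t u in \<open>auto intro: zero_dual0 add_dual0 minus_dual0 scale_dual0 J(1)\<close>)
  show ?thesis
    unfolding coframing_def comp_def using surj inj
    by (simp add: eta_map_add eta_map_scale linear_add[OF e_linear] linear_scale[OF e_linear])
qed

text \<open>Expanding the second leg of \<eta> in the basis turns \<eta> into the sum of \<eta>(F b)
  \<otimes> b; hence the metric is the same for all dual bases.\<close>

lemma metric_eq:
  assumes B: "dual_bases C B F"
  shows "tensor_eq ra la (metric C (e \<circ> eta_map C eta) B F) (image_mset (\<lambda>(x, y). (e x, e y)) eta)"
proof -
  have finB: "finite B" using B by (simp add: dual_bases_def)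
  let ?t = "image_mset (\<lambda>b. (eta_map C eta (F b), b)) (mset_set B)"
  have "ktensor_eq sV sV ?t eta"
  proof (rule V_tensor_eqI[OF B])
    fix f assume f: "f \<in> dual0 C"
    have "(\<Sum>(m, n)\<in>#?t. sV (f m) n) = (\<Sum>b\<in>#mset_set B. \<Sum>(x, y)\<in>#eta. sV (f x) (sV (F b y) b))"
    proof -
      have "sV (f (eta_map C eta g)) b = (\<Sum>(x, y)\<in>#eta. sV (f x) (sV (g y) b))" for g b
        unfolding eta_map_def
        by (simp add: linear_sum_mset[OF dual0_linear[OF f]] linear_scale[OF dual0_linear[OF f]]
            linear_sum_mset[OF linear_scaleV(2)[OF linear_field_id]] case_prod_unfold
            mult.commute)
      then show ?thesis by (simp add: image_mset.compositionality comp_def)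
    qed
    also have "\<dots> = (\<Sum>(x, y)\<in>#eta. sV (f x) (\<Sum>b\<in>#mset_set B. sV (F b y) b))"
      unfolding case_prod_unfold
      by (subst sum_mset.swap) (simp add: linear_sum_mset[OF linear_scaleV(1)[OF linear_idV]])
    also have "\<dots> = (\<Sum>(x, y)\<in>#eta. sV (f x) y)"
      using dual_basis_expansion[OF B] by (simp add: sum_unfold_sum_mset)
    finally show "(\<Sum>(m, n)\<in>#?t. sV (f m) n) = (\<Sum>(m, n)\<in>#eta. sV (f m) n)" .
  qed
  from Omega11_eq_e[OF this] show ?thesis
    by (simp add: metric_def image_mset.compositionality comp_def)
qed

text \<open>\<open>dual_coact\<close> is a choice and needs a witness: the sum of F b \<otimes> K b,
  where K v is the value prescribed at v and is linear in v.\<close>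

lemma dual_coact_properties:
  assumes B: "dual_bases C B F" and f: "f \<in> dual0 C"
  shows "set_mset (dual_coact C f) \<subseteq> dual0 C \<times> UNIV"
    and "(\<Sum>(f0, f1)\<in>#dual_coact C f. sH (f0 v) f1) = coact_sum v (\<lambda>v0 v1. sH (f v0) (T v1))"
proof -
  define K where "K v = coact_sum v (\<lambda>v0 v1. sH (f v0) (T v1))" for v
  have K: "Vector_Spaces.linear sV sH K"
    unfolding K_def by (intro linear_rules linear_dual f)
  let ?t = "image_mset (\<lambda>b. (F b, K b)) (mset_set B)"
  have "\<exists>t. set_mset t \<subseteq> dual0 C \<times> UNIV \<and> (\<forall>v. (\<Sum>(f0, f1)\<in>#t. sH (f0 v) f1) = K v)"
  proof (intro exI conjI allI)
    show "set_mset ?t \<subseteq> dual0 C \<times> UNIV"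
      using B by (auto simp: dual_bases_def)
    fix v
    have "K v = K (\<Sum>b\<in>#mset_set B. sV (F b v) b)"
      using dual_basis_expansion[OF B, of v] by (simp add: sum_unfold_sum_mset)
    also have "\<dots> = (\<Sum>(f0, f1)\<in>#?t. sH (f0 v) f1)"
      by (simp add: linear_sum_mset[OF K] linear_scale[OF K] image_mset.compositionality comp_def)
    finally show "(\<Sum>(f0, f1)\<in>#?t. sH (f0 v) f1) = K v" by simp
  qed
  from someI_ex[OF this]
  show "set_mset (dual_coact C f) \<subseteq> dual0 C \<times> UNIV"
    and "(\<Sum>(f0, f1)\<in>#dual_coact C f. sH (f0 v) f1) = coact_sum v (\<lambda>v0 v1. sH (f v0) (T v1))"
    unfolding dual_coact_def K_def coact_sum_def by blast+
qed

end

section \<open>Two-forms\<close>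

locale bicov_forms = bicov +
  assumes forms: "two_forms C"
begin

text \<open>Two-forms come with a bimodule structure only; letting scalars act through c 1 makes the
  linearity rules for Sweedler sums available for them.\<close>

definition sX where "sX c x = lact2 C (hscale C c 1) x"

lemma wedge_rules:
  "wedge C (m + m') n = wedge C m n + wedge C m' n"
  "wedge C m (n + n') = wedge C m n + wedge C m n'"
  "wedge C (ra m h) n = wedge C m (la h n)"
  "wedge C (la h m) n = lact2 C h (wedge C m n)"
  using forms by (simp_all add: two_forms_def)

lemma vector_space_sX: "vector_space sX"
proof -
  have "bimodule sH (lact2 C) (ract2 C)" using forms by (simp add: two_forms_def)
  then have "lact2 C a (x + y) = lact2 C a x + lact2 C a y"
    "lact2 C (a + b) x = lact2 C a x + lact2 C b x"
    "lact2 C (a * b) x = lact2 C a (lact2 C b x)" "lact2 C 1 x = x" for a b x y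
    unfolding bimodule_def by simp_all
  then show ?thesis
    by unfold_locales (simp_all add: sX_def H.scale_left_distrib scale_mult mult.commute
      flip: \<open>\<And>a b x. lact2 C (a * b) x = lact2 C a (lact2 C b x)\<close>)
qed

sublocale X: vector_space sX by (rule vector_space_sX)

lemma linear_wedge [linear_rules]:
  "Vector_Spaces.linear q sW f \<Longrightarrow> Vector_Spaces.linear q sX (\<lambda>x. wedge C (f x) n)"
  "Vector_Spaces.linear q sW f \<Longrightarrow> Vector_Spaces.linear q sX (\<lambda>x. wedge C n (f x))"
proof -
  have "wedge C (sW c m) n = sX c (wedge C m n)" "wedge C m (sW c n) = sX c (wedge C m n)" for c m n
    using wedge_rules(3)[of m "sH c 1" n] wedge_rules(4)[of "sH c 1" m n]
    by (simp_all add: scale1_def sX_def la_ra_scalar)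
  then show "Vector_Spaces.linear q sW f \<Longrightarrow> Vector_Spaces.linear q sX (\<lambda>x. wedge C (f x) n)"
    "Vector_Spaces.linear q sW f \<Longrightarrow> Vector_Spaces.linear q sX (\<lambda>x. wedge C n (f x))"
    by (simp_all add: Vector_Spaces.linear_iff wedge_rules X.vector_space_axioms)
qed

lemma linear_scaleX [linear_rules]:
  "Vector_Spaces.linear q sX f \<Longrightarrow> Vector_Spaces.linear q sX (\<lambda>x. sX c (f x))"
  "Vector_Spaces.linear q (*) g \<Longrightarrow> Vector_Spaces.linear q sX (\<lambda>x. sX (g x) v)"
  by (simp_all add: Vector_Spaces.linear_iff algebra_simps X.scale_left_distrib X.scale_right_distrib
    X.vector_space_axioms)

text \<open>\<open>Psi\<close> is additive only up to congruence, so its value on the empty sum is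
  found by cancellation. The formula on e \<otimes> e is the defining one for the chosen lift of w,
  rewritten with the coaction.\<close>

lemma
  shows Psi_add: "tensor_eq ra la (Psi C (t + u)) (Psi C t + Psi C u)"
    and Psi_e: "tensor_eq ra la (Psi C {#(e v, e w)#})
      (image_mset (\<lambda>(w0, w1). (e w0, e (act0 C v w1))) (coact0 C w))"
    and Psi_empty: "tensor_eq ra la (Psi C {#}) {#}"
proof -
  have P: "is_Psi C" using forms by (simp add: two_forms_def)
  then show add: "tensor_eq ra la (Psi C (t + u)) (Psi C t + Psi C u)" for t u
    unfolding is_Psi_def by blast
  show "tensor_eq ra la (Psi C {#}) {#}"
    by (rule additive_congruence_cancel[OF tensor_eq_negative, of _ _ "Psi C {#}"])
      (use add[of "{#}" "{#}"] in \<open>simp add: additive_congruence.sym\<close>)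
  have "tensor_eq ra la (Psi C {#(e v, e (proj0 C g))#})
        (image_mset (\<lambda>(a, b, c). (e (P b), e (act0 C v (S a * c)))) (comult2 C g))"
    if "\<epsilon> g = 0" for v g
    using P that unfolding is_Psi_def ker_counit_def by blast
  from this[OF lift0(1)[of w]]
  show "tensor_eq ra la (Psi C {#(e v, e w)#})
      (image_mset (\<lambda>(w0, w1). (e w0, e (act0 C v w1))) (coact0 C w))"
    by (simp add: lift0 coact0_def Ad_def image_mset.compositionality comp_def case_prod_unfold)
qed

lemma Psi_metric:
  "tensor_eq ra la (Psi C (image_mset (\<lambda>(x, y). (e x, e y)) eta))
    (image_mset (\<lambda>(x, y). (e x, e y))
      (\<Sum>(x, y)\<in>#eta. image_mset (\<lambda>(y0, y1). (y0, act0 C x y1)) (coact0 C y)))"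
proof (induction eta)
  case empty
  then show ?case by (simp add: Psi_empty)
next
  case (add p eta)
  obtain x y where p: "p = (x, y)" by force
  have "tensor_eq ra la (Psi C ({#(e x, e y)#} + image_mset (\<lambda>(x, y). (e x, e y)) eta))
      (image_mset (\<lambda>(w0, w1). (e w0, e (act0 C x w1))) (coact0 C y) +
        image_mset (\<lambda>(x, y). (e x, e y))
      (\<Sum>(x, y)\<in>#eta. image_mset (\<lambda>(y0, y1). (y0, act0 C x y1)) (coact0 C y)))"
    by (rule additive_congruence.trans[OF Psi_add additive_congruence_add[OF Psi_e add]])
  then show ?case
    by (simp add: p image_mset.compositionality comp_def case_prod_unfold)
qed

text \<open>By invariance, \<open>\<Psi>(g)\<close> is the metric of \<open>\<eta>\<^sup>(\<^sup>2\<^sup>) \<otimes> S\<^sup>2\<eta>\<^sup>(\<^sup>1\<^sup>)\<close>.\<close>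

lemma wedge_metric_eq_0_iff:
  assumes B: "dual_bases C B F" and inv: "Ad_invariant C eta"
  shows "wedge_quotient C (image_mset (\<lambda>(x, y). (e x, e y)) eta) = 0 \<longleftrightarrow>
    ktensor_eq sV sV eta (image_mset (\<lambda>(x, y). (y, Ssq0 C x)) eta)"
proof -
  let ?g = "image_mset (\<lambda>(x, y). (e x, e y))"
  let ?flip = "image_mset (\<lambda>(x, y). (y, Ssq0 C x)) eta"
  let ?t = "\<Sum>(x, y)\<in>#eta. image_mset (\<lambda>(y0, y1). (y0, act0 C x y1)) (coact0 C y)"
  have "ktensor_eq sV sV ?t ?flip"
  \<comment> \<open>Contracting the left leg with f leaves an expression trilinear in x, y_0 and
    y_1, to which invariance applies.\<close>
  proof (rule V_tensor_eqI[OF B])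
    fix f assume f: "f \<in> dual0 C"
    have "(\<Sum>(m, n)\<in>#?t. sV (f m) n) = (\<Sum>(x, y)\<in>#eta. coact_sum y (\<lambda>y0 y1. sV (f y0) (act0 C x y1)))"
      unfolding case_prod_unfold sum_mset_sum_mset coact_sum_def
      by (simp add: image_mset.compositionality comp_def)
    also have "\<dots> = (\<Sum>(x, y)\<in>#eta. coact_sum x (\<lambda>x0 x1. sV (f y) (act0 C x0 (S x1))))"
      by (rule Ad_invariant_sum[OF inv, where r = sV]) (intro linear_rules linear_dual f)+
    also have "\<dots> = (\<Sum>(m, n)\<in>#?flip. sV (f m) n)"
      by (simp add: coact_sum_out[OF linear_scaleV(1)[OF linear_idV], symmetric] coact_sum_act0_antipode
          image_mset.compositionality comp_def case_prod_unfold)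
    finally show "(\<Sum>(m, n)\<in>#?t. sV (f m) n) = (\<Sum>(m, n)\<in>#?flip. sV (f m) n)" .
  qed
  then have Psi: "tensor_eq ra la (Psi C (?g eta)) (?g ?flip)"
    by (rule additive_congruence.trans[OF Psi_metric Omega11_eq_e])
  have "wedge_quotient C (?g eta) = 0 \<longleftrightarrow> tensor_eq ra la (?g eta) (Psi C (?g eta))"
    using forms by (simp add: two_forms_def wedge_quotient_def)
  also have "\<dots> \<longleftrightarrow> tensor_eq ra la (?g eta) (?g ?flip)"
    by (rule iffI) (erule additive_congruence.trans[OF _ Psi],
        erule additive_congruence.trans[OF _ additive_congruence.sym[OF Psi]])
  also have "\<dots> \<longleftrightarrow> ktensor_eq sV sV eta ?flip"
    using e_tensor_inject[OF B] Omega11_eq_e by blast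
  finally show ?thesis .
qed

section \<open>Covariant derivatives of the frame and the coframe\<close>

context
  fixes A assumes A: "gauge_field C A"
begin

lemma linear_A: "Vector_Spaces.linear q sV f \<Longrightarrow> Vector_Spaces.linear q sW (\<lambda>x. A (f x))"
  using A unfolding gauge_field_def by (rule linear_comp)

lemma linear_frame_term:
  "Vector_Spaces.linear sV sX (\<lambda>u. wedge C (e u) (A (P h)))"
  "Vector_Spaces.linear sH sX (\<lambda>h. wedge C (e u) (A (P h)))"
  by (intro linear_rules linear_A)+

lemma D_frame_eq: "D_frame C A v = extd C (e v) + coact_sum v (\<lambda>v0 v1. wedge C (e v0) (A (P v1)))"
  using sum_comult2[of "\<lambda>a b c. wedge C (e (P b)) (A (P (S a * c)))" "lift0 C v"]
  by (simp add: D_frame_def D_frame_lift_def lift0 coact_sum_lift0)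

text \<open>\<open>coact_sum_P\<close> evaluates the coaction on any representative, so the lift
  does not matter.\<close>

lemma D_frame_lift_eq:
  assumes "\<epsilon> h = 0"
  shows "D_frame_lift C A h = D_frame C A (proj0 C h)"
  unfolding D_frame_eq
  using sum_comult2[of "\<lambda>a b c. wedge C (e (P b)) (A (P (S a * c)))" h]
    coact_sum_P[OF linear_frame_term, of h]
  by (simp add: D_frame_lift_def P_proj0[OF assms])

text \<open>The exterior derivatives coincide, so only the connection terms are compared. The dual
  coaction puts S^-1 on the coaction of the second leg of \<eta>; moving that coaction to the first
  leg introduces S, and the two cancel.\<close>

lemma D_coframe_eq:
  assumes B: "dual_bases C B F" and inv: "Ad_invariant C eta" and f: "f \<in> dual0 C"
  shows "D_coframe C A (e \<circ> eta_map C eta) f = D_frame C A (eta_map C eta f)"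
proof -
  let ?w = "\<lambda>v h. wedge C (e v) (A (P h))"
  have "(\<Sum>(f0, f1)\<in>#dual_coact C f. ?w (eta_map C eta f0) f1) =
      (\<Sum>(f0, f1)\<in>#dual_coact C f. \<Sum>(x, y)\<in>#eta. ?w x (sH (f0 y) f1))"
    unfolding eta_map_def
    by (simp add: linear_sum_mset[OF linear_frame_term(1)] linear_scale[OF linear_frame_term(1)]
        linear_scale[OF linear_frame_term(2)] case_prod_unfold)
  \<comment> \<open>The dual coaction is known only through evaluation at vectors, so its sum is
    brought inside, next to y.\<close>
  also have "\<dots> = (\<Sum>(x, y)\<in>#eta. ?w x (\<Sum>(f0, f1)\<in>#dual_coact C f. sH (f0 y) f1))"
    unfolding case_prod_unfold
    by (subst sum_mset.swap) (simp add: linear_sum_mset[OF linear_frame_term(2)])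
  also have "\<dots> = (\<Sum>(x, y)\<in>#eta. coact_sum y (\<lambda>y0 y1. sX (f y0) (?w x (T y1))))"
    unfolding dual_coact_properties(2)[OF B f]
    by (simp add: coact_sum_out[OF linear_frame_term(2)] linear_scale[OF linear_frame_term(2)])
  also have "\<dots> = (\<Sum>(x, y)\<in>#eta. coact_sum x (\<lambda>x0 x1. sX (f y) (?w x0 (T (S x1)))))"
    by (rule Ad_invariant_sum[OF inv, where r = sX]) (intro linear_rules linear_A linear_dual f)+
  also have "\<dots> = coact_sum (eta_map C eta f) ?w"
  proof -
    have lin: "Vector_Spaces.linear sV sX (\<lambda>v. coact_sum v ?w)"
      by (intro linear_rules linear_A)
    have "coact_sum (eta_map C eta f) ?w = (\<Sum>(x, y)\<in>#eta. sX (f y) (coact_sum x ?w))"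
      unfolding eta_map_def
      by (simp add: linear_sum_mset[OF lin] linear_scale[OF lin] case_prod_unfold)
    then show ?thesis
      by (simp add: coact_sum_out[OF linear_scaleX(1)[OF X.linear_id[unfolded id_def]]])
  qed
  finally show ?thesis by (simp add: D_coframe_def D_frame_eq)
qed

end

end

theorem proposition4p2:
  fixes C :: "('k::field, 'h::ring_1, 'v::ab_group_add, 'w::ab_group_add, 'x::ab_group_add) calculus"
    and eta :: "('v \<times> 'v) multiset"
  assumes hopf: "hopf_algebra C"
    and antipode: "bij (antipode C)"
    and calc: "bicovariant_calculus C"
    and fin: "finite_dimensional (vscale C)"
    and forms: "two_forms C"
    and inv: "Ad_invariant C eta"
    and nondeg: "nondegenerate C eta"
  defines "E \<equiv> maurer_cartan C \<circ> eta_map C eta"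
    and "g \<equiv> image_mset (\<lambda>(x, y). (maurer_cartan C x, maurer_cartan C y)) eta"
  shows
    "coframing C E \<and>
     (\<forall>B F. dual_bases C B F \<longrightarrow> Omega11_eq C (metric C E B F) g) \<and>
     (wedge_quotient C g = 0 \<longleftrightarrow>
       ktensor_eq (vscale C) (vscale C) eta (image_mset (\<lambda>(x, y). (y, Ssq0 C x)) eta)) \<and>
     (\<forall>A. gauge_field C A \<longrightarrow>
       (\<forall>h\<in>ker_counit C. D_frame C A (proj0 C h) = D_frame_lift C A h) \<and>
       (\<forall>f\<in>dual0 C. D_coframe C A E f = D_frame C A (eta_map C eta f)) \<and>
       (\<forall>B F. dual_bases C B F \<longrightarrow>
         tensor_eq (ract2 C) (lact1 C) (cotorsion C A E B F)
           (image_mset (\<lambda>b. (D_frame C A (eta_map C eta (F b)), maurer_cartan C b)) (mset_set B))))"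
proof -
  interpret bicov_forms C
    using hopf antipode calc forms by unfold_locales
  obtain B0 F0 where B0: "dual_bases C B0 F0"
    using fin by (rule dual_bases_exist)
  \<comment> \<open>The two formal sums agree term by term, so the tensor equation for the cotorsion
    becomes reflexivity.\<close>
  have cot: "cotorsion C A E B F =
      image_mset (\<lambda>b. (D_frame C A (eta_map C eta (F b)), maurer_cartan C b)) (mset_set B)"
    if "gauge_field C A" "dual_bases C B F" for A B F
    unfolding cotorsion_def E_def
    using that(2) D_coframe_eq[OF that inv] by (intro image_mset_cong) (auto simp: dual_bases_def)
  show ?thesis
  proof (intro conjI allI impI ballI)
    show "coframing C E"
      unfolding E_def by (rule coframing_eta[OF B0 nondeg])
    show "tensor_eq ra la (metric C E B F) g" if "dual_bases C B F" for B F
      unfolding E_def g_def by (rule metric_eq[OF that])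
    show "wedge_quotient C g = 0 \<longleftrightarrow>
        ktensor_eq sV sV eta (image_mset (\<lambda>(x, y). (y, Ssq0 C x)) eta)"
      unfolding g_def by (rule wedge_metric_eq_0_iff[OF B0 inv])
    fix A assume A: "gauge_field C A"
    show "D_frame C A (proj0 C h) = D_frame_lift C A h" if "h \<in> ker_counit C" for h
      using D_frame_lift_eq[OF A, of h] that by (simp add: ker_counit_def)
    show "D_coframe C A E f = D_frame C A (eta_map C eta f)" if "f \<in> dual0 C" for f
      unfolding E_def by (rule D_coframe_eq[OF A B0 inv that])
    show "tensor_eq (ract2 C) la (cotorsion C A E B F)
        (image_mset (\<lambda>b. (D_frame C A (eta_map C eta (F b)), e b)) (mset_set B))"
      if "dual_bases C B F" for B F
      unfolding cot[OF A that] by (rule additive_congruence.refl)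
  qed
qed

end
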